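(* Let $\mathcal C$ be a dagger category whose objects are orthosets of at most countable rank, whose morphisms are maps between them, and whose dagger assigns to each morphism an adjoint of it, and assume that $\mathcal C$ contains an orthoset of non-zero rank. Assume that: (H1) $\mathcal C$ has dagger biproducts. (H2) For every $X\in\mathcal C$ and every subspace $A$ of $X$, the orthosets $A$, $A^\perp$ and the inclusion maps $\iota_A\colon A\to X$, $\iota_{A^\perp}\colon A^\perp\to X$ belong to $\mathcal C$, and $A\xrightarrow{\iota_A}X\xleftarrow{\iota_{A^\perp}}A^\perp$ is a dagger biproduct of $A$ and $A^\perp$. (H3) (a) Any unital orthoset in $\mathcal C$ is dagger simple. (b) Any two unital orthosets in $\mathcal C$ are dagger isomorphic. Let the $\ast$-sfield $F$ and the assignment $\mathsf L$ on objects and morphisms of $\mathcal C$ be constructed as described in the context. Then $\mathsf L$ is a dagger functor from $\mathcal C$ to $\mathcal{OMS}_F$.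
   Context: Orthosets: An orthoset is a non-empty set $X$ with a binary relation $\perp$ and a constant $0\in X$ such that $x\perp y$ implies $y\perp x$, $x\perp x$ only if $x=0$, and $0\perp x$ for all $x\in X$. An element $\neq 0$ is called proper. For $A\subseteq X$ put $A^\perp=\{x\in X: x\perp y\text{ for all }y\in A\}$; $A$ is orthoclosed if $A^{\perp\perp}=A$. A subspace of $X$ is an orthoclosed subset with the restricted relation and the same $0$ (again an orthoset). The rank of $X$ is the supremum of the cardinalities of sets of mutually orthogonal proper elements. $X$ is unital if there is a proper $z\in X$ such that no proper element of $X$ is orthogonal to $z$. A map $g\colon Y\to X$ is an adjoint of $f\colon X\to Y$ if for all $x\in X,y\in Y$: $f(x)\perp y$ iff $x\perp g(y)$. Write $x\parallel y$ if $\{x\}^\perp=\{y\}^\perp$, $[x]$ for the $\parallel$-class of $x$, and $P(X)=\{[x]:x\in X\}$, an orthoset with $[x]\perp[y]$ iff $x\perp y$ and constant $[0]$. A map $f\colon X\to Y$ possessing an adjoint preserves $\parallel$ and induces $P(f)\colon P(X)\to P(Y)$, $[x]\mapsto[f(x)]$. An orthoisomorphism is a bijection between orthosets preserving and reflecting $\perp$. Dagger categories: A dagger on a category is an involutive functor $^\ast\colon\mathcal C^{op}\to\mathcal C$ that is the identity on objects. A morphism $f\colon A\to B$ is an isometry (dagger monomorphism) if $f^\ast\circ f=\mathrm{id}_A$, a dagger isomorphism if moreover $f\circ f^\ast=\mathrm{id}_B$. If there is a zero object $0$, the zero map $0_{A,B}\colon A\to B$ is the unique morphism factoring through $0$. A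 dagger biproduct of $A,B$ is a coproduct $A\xrightarrow{\iota_A}A\oplus B\xleftarrow{\iota_B}B$ with $\iota_A,\iota_B$ dagger monomorphisms and $\iota_B^\ast\circ\iota_A=0_{A,B}$; for $f\colon A\to C$, $g\colon B\to D$, $f\oplus g$ is the unique morphism with $(f\oplus g)\circ\iota_A=\iota_C\circ f$, $(f\oplus g)\circ\iota_B=\iota_D\circ g$. "$\mathcal C$ has dagger biproducts" means that $\mathcal C$ has a zero object and every pair of objects has a dagger biproduct. An object $X$ is dagger simple if it is non-zero and any dagger monomorphism from a non-zero object to $X$ is a dagger isomorphism. A dagger functor is a functor preserving daggers. Orthomodular spaces: A $\ast$-sfield is a skew field with an involutory antiautomorphism $^\ast$. A Hermitian space over a $\ast$-sfield $F$ is a (left) linear space $H$ over $F$ with a map $(\cdot,\cdot)\colon H\times H\to F$ that is linear in the first argument, satisfies $(w,\alpha u+\beta v)=(w,u)\alpha^\ast+(w,v)\beta^\ast$ and $(u,v)=(v,u)^\ast$, and is anisotropic ($(u,u)=0$ implies $u=0$); it is an orthoset with $u\perp v$ iff $(u,v)=0$ and constant the zero vector, and is assumed to contain at most countably many pairwise orthogonal non-zero vectors. Its dimension is the cardinality of any maximal set of pairwise orthogonal non-zero vectors. A subspace of $H$ is an orthoclosed subset with the restricted linear structure and form. $H$ is orthomodular if $H=S+S^\perp$ for every subspace $S$, and uniform if each $1$-dimensional subspace contains a vector $u$ with $(u,u)=1$. A linear adjoint of a linear map $\phi\colon H_1\to H_2$ is a map $\phi^\ast\colon H_2\to H_1$ with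 $(\phi(u),v)=(u,\phi^\ast(v))$ for all $u,v$; a linear map is adjointable if it has a linear adjoint (equivalently, an adjoint as a map of orthosets). A linear map $\phi$ induces $P(\phi)\colon[u]\mapsto[\phi(u)]$. $\mathcal{OMS}_F$ is the dagger category of uniform orthomodular spaces over $F$, adjointable linear maps, and the linear adjoint as dagger. Construction of $F$ and $\mathsf L$: Fix $Z\in\mathcal C$ of rank $3$, a $3$-dimensional uniform orthomodular space $H^Z$ and an orthoisomorphism $r\colon P(Z)\to P(H^Z)$; $F$ is the scalar $\ast$-sfield of $H^Z$. For each $X\in\mathcal C$ take the dagger biproduct $X\xrightarrow{\iota_X}X\oplus Z\xleftarrow{\iota_Z}Z$ and choose a uniform orthomodular space $\overline{H_X}$ over $F$ containing $H^Z$ as a subspace together with an orthoisomorphism $\bar r_X\colon P(X\oplus Z)\to P(\overline{H_X})$ such that $\bar r_X\circ P(\iota_Z)=P(\iota_{H^Z})\circ r$, where $\iota_{H^Z}\colon H^Z\to\overline{H_X}$ is the inclusion. Let $H_X$ be the orthocomplement of $H^Z$ in $\overline{H_X}$, so $\overline{H_X}=H_X\oplus H^Z$, and let $r_X\colon P(X)\to P(H_X)$ be the orthoisomorphism with $\bar r_X\circ P(\iota_X)=P(\iota_{H_X})\circ r_X$. Put $\mathsf L(X)=H_X$. For a morphism $f\colon X\to Y$, $\mathsf L(f)$ is the unique linear map $\phi\colon H_X\to H_Y$ such that $\bar r_Y\circ P(f\oplus\mathrm{id}_Z)=P(\phi\oplus\mathrm{id}_{H^Z})\circ\bar r_X$.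 (Such choices exist and $\phi$ exists uniquely.) *)

theory Defs
  imports
    "HOL-Algebra.Group"
    "HOL-Library.FuncSet"
    "HOL-Library.Countable_Set"
    "HOL-Library.Extended_Nat"
begin

section \<open>Orthosets\<close>

record 'a orthostruct =
  ocarrier :: "'a set"
  operp :: "'a \<Rightarrow> 'a \<Rightarrow> bool"
  ozero :: 'a

text \<open>The relation is required to live on the carrier only, so that two orthosets with the
  same elements, the same relation and the same constant are equal as records.\<close>

locale orthoset =
  fixes X :: "'a orthostruct"
  assumes zero_closed: "ozero X \<in> ocarrier X"
    and perp_on_carrier: "operp X x y \<Longrightarrow> x \<in> ocarrier X \<and> y \<in> ocarrier X"
    and perp_sym: "operp X x y \<Longrightarrow> operp X y x"
    and perp_self: "operp X x x \<Longrightarrow> x = ozero X"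
    and zero_perp: "x \<in> ocarrier X \<Longrightarrow> operp X (ozero X) x"

definition proper :: "'a orthostruct \<Rightarrow> 'a \<Rightarrow> bool" where
  "proper X x \<longleftrightarrow> x \<in> ocarrier X \<and> x \<noteq> ozero X"

definition orthocomp :: "'a orthostruct \<Rightarrow> 'a set \<Rightarrow> 'a set" where
  "orthocomp X A = {x \<in> ocarrier X. \<forall>y\<in>A. operp X x y}"

definition orthoclosed :: "'a orthostruct \<Rightarrow> 'a set \<Rightarrow> bool" where
  "orthoclosed X A \<longleftrightarrow> A \<subseteq> ocarrier X \<and> orthocomp X (orthocomp X A) = A"

definition sub_orthoset :: "'a orthostruct \<Rightarrow> 'a set \<Rightarrow> 'a orthostruct" where
  "sub_orthoset X A =
     \<lparr>ocarrier = A, operp = (\<lambda>x y. x \<in> A \<and> y \<in> A \<and> operp X x y), ozero = ozero X\<rparr>"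

definition orthogonal_set :: "'a orthostruct \<Rightarrow> 'a set \<Rightarrow> bool" where
  "orthogonal_set X D \<longleftrightarrow> (\<forall>x\<in>D. proper X x) \<and> pairwise (operp X) D"

definition countable_rank :: "'a orthostruct \<Rightarrow> bool" where
  "countable_rank X \<longleftrightarrow> (\<forall>D. orthogonal_set X D \<longrightarrow> countable D)"

text \<open>All infinite cardinalities are identified with \<open>\<infinity>\<close>; no information is lost as long as
  \<^const>\<open>countable_rank\<close> holds.\<close>

definition rank :: "'a orthostruct \<Rightarrow> enat" where
  "rank X = (SUP D \<in> Collect (orthogonal_set X). if finite D then enat (card D) else \<infinity>)"

definition unital :: "'a orthostruct \<Rightarrow> bool" where
  "unital X \<longleftrightarrow> (\<exists>z. proper X z \<and> (\<forall>x. proper X x \<longrightarrow> \<not> operp X x z))"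

definition orthoset_adjoint ::
  "'a orthostruct \<Rightarrow> 'b orthostruct \<Rightarrow> ('a \<Rightarrow> 'b) \<Rightarrow> ('b \<Rightarrow> 'a) \<Rightarrow> bool" where
  "orthoset_adjoint X Y f g \<longleftrightarrow>
     (\<forall>x\<in>ocarrier X. \<forall>y\<in>ocarrier Y. operp Y (f x) y \<longleftrightarrow> operp X x (g y))"

definition orthoisomorphism ::
  "'a orthostruct \<Rightarrow> 'b orthostruct \<Rightarrow> ('a \<Rightarrow> 'b) \<Rightarrow> bool" where
  "orthoisomorphism X Y f \<longleftrightarrow>
     bij_betw f (ocarrier X) (ocarrier Y) \<and>
     (\<forall>x\<in>ocarrier X. \<forall>y\<in>ocarrier X. operp X x y \<longleftrightarrow> operp Y (f x) (f y))"

definition par :: "'a orthostruct \<Rightarrow> 'a \<Rightarrow> 'a \<Rightarrow> bool" where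
  "par X x y \<longleftrightarrow> orthocomp X {x} = orthocomp X {y}"

definition par_class :: "'a orthostruct \<Rightarrow> 'a \<Rightarrow> 'a set" where
  "par_class X x = {y \<in> ocarrier X. par X x y}"

definition P_orthoset :: "'a orthostruct \<Rightarrow> 'a set orthostruct" where
  "P_orthoset X =
     \<lparr>ocarrier = par_class X ` ocarrier X,
      operp = (\<lambda>p q. \<exists>x\<in>ocarrier X. \<exists>y\<in>ocarrier X.
                 p = par_class X x \<and> q = par_class X y \<and> operp X x y),
      ozero = par_class X (ozero X)\<rparr>"

text \<open>The elements of a class \<open>p\<close> are exactly its representatives, so for a map \<open>f\<close> that preserves
  \<^const>\<open>par\<close> the image below is a singleton and \<open>P_map X Y f [x] = [f x]\<close>.\<close>

definition P_map ::
  "'a orthostruct \<Rightarrow> 'b orthostruct \<Rightarrow> ('a \<Rightarrow> 'b) \<Rightarrow> 'a set \<Rightarrow> 'b set" where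
  "P_map X Y f =
     (\<lambda>p\<in>ocarrier (P_orthoset X). the_elem ((\<lambda>x. par_class Y (f x)) ` p))"


section \<open>Dagger categories\<close>

record ('o, 'm) dagcat =
  Obj :: "'o set"
  Hom :: "'o \<Rightarrow> 'o \<Rightarrow> 'm set"
  Idn :: "'o \<Rightarrow> 'm"
  Comp :: "'o \<Rightarrow> 'o \<Rightarrow> 'o \<Rightarrow> 'm \<Rightarrow> 'm \<Rightarrow> 'm"
  Dag :: "'o \<Rightarrow> 'o \<Rightarrow> 'm \<Rightarrow> 'm"

text \<open>\<open>Comp C A B D g f\<close> is the composite of \<open>f : A \<rightarrow> B\<close> followed by \<open>g : B \<rightarrow> D\<close>, and
  \<open>Dag C A B f : B \<rightarrow> A\<close> is the dagger of \<open>f : A \<rightarrow> B\<close>.\<close>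

locale dagger_category =
  fixes C :: "('o, 'm) dagcat"
  assumes Idn_hom: "A \<in> Obj C \<Longrightarrow> Idn C A \<in> Hom C A A"
    and Comp_hom: "\<lbrakk>A \<in> Obj C; B \<in> Obj C; D \<in> Obj C; f \<in> Hom C A B; g \<in> Hom C B D\<rbrakk>
      \<Longrightarrow> Comp C A B D g f \<in> Hom C A D"
    and Comp_Idn: "\<lbrakk>A \<in> Obj C; B \<in> Obj C; f \<in> Hom C A B\<rbrakk> \<Longrightarrow> Comp C A A B f (Idn C A) = f"
    and Idn_Comp: "\<lbrakk>A \<in> Obj C; B \<in> Obj C; f \<in> Hom C A B\<rbrakk> \<Longrightarrow> Comp C A B B (Idn C B) f = f"
    and Comp_assoc: "\<lbrakk>A \<in> Obj C; B \<in> Obj C; D \<in> Obj C; E \<in> Obj C;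
        f \<in> Hom C A B; g \<in> Hom C B D; h \<in> Hom C D E\<rbrakk>
      \<Longrightarrow> Comp C A D E h (Comp C A B D g f) = Comp C A B E (Comp C B D E h g) f"
    and Dag_hom: "\<lbrakk>A \<in> Obj C; B \<in> Obj C; f \<in> Hom C A B\<rbrakk> \<Longrightarrow> Dag C A B f \<in> Hom C B A"
    and Dag_Idn: "A \<in> Obj C \<Longrightarrow> Dag C A A (Idn C A) = Idn C A"
    and Dag_Comp: "\<lbrakk>A \<in> Obj C; B \<in> Obj C; D \<in> Obj C; f \<in> Hom C A B; g \<in> Hom C B D\<rbrakk>
      \<Longrightarrow> Dag C A D (Comp C A B D g f) = Comp C D B A (Dag C A B f) (Dag C B D g)"
    and Dag_Dag: "\<lbrakk>A \<in> Obj C; B \<in> Obj C; f \<in> Hom C A B\<rbrakk> \<Longrightarrow> Dag C B A (Dag C A B f) = f"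

definition dagger_mono :: "('o, 'm) dagcat \<Rightarrow> 'o \<Rightarrow> 'o \<Rightarrow> 'm \<Rightarrow> bool" where
  "dagger_mono C A B f \<longleftrightarrow> f \<in> Hom C A B \<and> Comp C A B A (Dag C A B f) f = Idn C A"

definition dagger_iso :: "('o, 'm) dagcat \<Rightarrow> 'o \<Rightarrow> 'o \<Rightarrow> 'm \<Rightarrow> bool" where
  "dagger_iso C A B f \<longleftrightarrow> dagger_mono C A B f \<and> Comp C B A B f (Dag C A B f) = Idn C B"

definition zero_object :: "('o, 'm) dagcat \<Rightarrow> 'o \<Rightarrow> bool" where
  "zero_object C N \<longleftrightarrow> N \<in> Obj C \<and>
     (\<forall>A\<in>Obj C. (\<exists>!f. f \<in> Hom C A N) \<and> (\<exists>!f. f \<in> Hom C N A))"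

definition zero_map :: "('o, 'm) dagcat \<Rightarrow> 'o \<Rightarrow> 'o \<Rightarrow> 'm" where
  "zero_map C A B = (THE f. \<exists>N g h. zero_object C N \<and> g \<in> Hom C A N \<and> h \<in> Hom C N B \<and>
     f = Comp C A N B h g)"

definition coproduct :: "('o, 'm) dagcat \<Rightarrow> 'o \<Rightarrow> 'o \<Rightarrow> 'o \<Rightarrow> 'm \<Rightarrow> 'm \<Rightarrow> bool" where
  "coproduct C A B S i j \<longleftrightarrow>
     S \<in> Obj C \<and> i \<in> Hom C A S \<and> j \<in> Hom C B S \<and>
     (\<forall>D\<in>Obj C. \<forall>f\<in>Hom C A D. \<forall>g\<in>Hom C B D.
        \<exists>!h. h \<in> Hom C S D \<and> Comp C A S D h i = f \<and> Comp C B S D h j = g)"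

definition dagger_biproduct :: "('o, 'm) dagcat \<Rightarrow> 'o \<Rightarrow> 'o \<Rightarrow> 'o \<Rightarrow> 'm \<Rightarrow> 'm \<Rightarrow> bool" where
  "dagger_biproduct C A B S i j \<longleftrightarrow>
     coproduct C A B S i j \<and> dagger_mono C A S i \<and> dagger_mono C B S j \<and>
     Comp C A S B (Dag C B S j) i = zero_map C A B"

definition has_dagger_biproducts :: "('o, 'm) dagcat \<Rightarrow> bool" where
  "has_dagger_biproducts C \<longleftrightarrow>
     (\<exists>N. zero_object C N) \<and>
     (\<forall>A\<in>Obj C. \<forall>B\<in>Obj C. \<exists>S i j. dagger_biproduct C A B S i j)"

text \<open>\<open>biproduct_map C A B S i j A' B' S' i' j' f g\<close> is \<open>f \<oplus> g\<close> for \<open>f : A \<rightarrow> A'\<close>, \<open>g : B \<rightarrow> B'\<close>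
  with respect to the biproducts \<open>(S, i, j)\<close> and \<open>(S', i', j')\<close>.\<close>

definition biproduct_map :: "('o, 'm) dagcat \<Rightarrow> 'o \<Rightarrow> 'o \<Rightarrow> 'o \<Rightarrow> 'm \<Rightarrow> 'm
    \<Rightarrow> 'o \<Rightarrow> 'o \<Rightarrow> 'o \<Rightarrow> 'm \<Rightarrow> 'm \<Rightarrow> 'm \<Rightarrow> 'm \<Rightarrow> 'm" where
  "biproduct_map C A B S i j A' B' S' i' j' f g =
     (THE h. h \<in> Hom C S S' \<and> Comp C A S S' h i = Comp C A A' S' i' f \<and>
             Comp C B S S' h j = Comp C B B' S' j' g)"

definition dagger_simple :: "('o, 'm) dagcat \<Rightarrow> 'o \<Rightarrow> bool" where
  "dagger_simple C X \<longleftrightarrow> \<not> zero_object C X \<and>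
     (\<forall>A\<in>Obj C. \<forall>f. \<not> zero_object C A \<and> dagger_mono C A X f \<longrightarrow> dagger_iso C A X f)"

locale dagger_functor =
  source: dagger_category C + target: dagger_category D
  for C :: "('o, 'm) dagcat" and D :: "('p, 'n) dagcat" +
  fixes FO :: "'o \<Rightarrow> 'p" and FM :: "'o \<Rightarrow> 'o \<Rightarrow> 'm \<Rightarrow> 'n"
  assumes FO_obj: "A \<in> Obj C \<Longrightarrow> FO A \<in> Obj D"
    and FM_hom: "\<lbrakk>A \<in> Obj C; B \<in> Obj C; f \<in> Hom C A B\<rbrakk> \<Longrightarrow> FM A B f \<in> Hom D (FO A) (FO B)"
    and FM_Idn: "A \<in> Obj C \<Longrightarrow> FM A A (Idn C A) = Idn D (FO A)"
    and FM_Comp: "\<lbrakk>A \<in> Obj C; B \<in> Obj C; E \<in> Obj C; f \<in> Hom C A B; g \<in> Hom C B E\<rbrakk>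
      \<Longrightarrow> FM A E (Comp C A B E g f) = Comp D (FO A) (FO B) (FO E) (FM B E g) (FM A B f)"
    and FM_Dag: "\<lbrakk>A \<in> Obj C; B \<in> Obj C; f \<in> Hom C A B\<rbrakk>
      \<Longrightarrow> FM B A (Dag C A B f) = Dag D (FO A) (FO B) (FM A B f)"


section \<open>Dagger categories of orthosets\<close>

text \<open>Maps are represented by functions that are \<^const>\<open>undefined\<close> outside their domain, so that
  equality of morphisms is equality of functions.\<close>

locale orthoset_dagger_category = dagger_category C
  for C :: "('a orthostruct, 'a \<Rightarrow> 'a) dagcat" +
  assumes obj_orthoset: "X \<in> Obj C \<Longrightarrow> orthoset X"
    and obj_countable_rank: "X \<in> Obj C \<Longrightarrow> countable_rank X"
    and hom_maps: "\<lbrakk>X \<in> Obj C; Y \<in> Obj C\<rbrakk> \<Longrightarrow> Hom C X Y \<subseteq> ocarrier X \<rightarrow>\<^sub>E ocarrier Y"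
    and Idn_map: "X \<in> Obj C \<Longrightarrow> Idn C X = (\<lambda>x\<in>ocarrier X. x)"
    and Comp_map: "\<lbrakk>X \<in> Obj C; Y \<in> Obj C; W \<in> Obj C; f \<in> Hom C X Y; g \<in> Hom C Y W\<rbrakk>
      \<Longrightarrow> Comp C X Y W g f = compose (ocarrier X) g f"
    and Dag_adjoint: "\<lbrakk>X \<in> Obj C; Y \<in> Obj C; f \<in> Hom C X Y\<rbrakk>
      \<Longrightarrow> orthoset_adjoint X Y f (Dag C X Y f)"


section \<open>Orthomodular spaces\<close>

text \<open>The elements of the \<open>\<ast>\<close>-sfield are those of a type of class \<^class>\<open>division_ring\<close>.\<close>

locale star_sfield =
  fixes star :: "'f::division_ring \<Rightarrow> 'f"
  assumes star_add: "star (a + b) = star a + star b"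
    and star_mult: "star (a * b) = star b * star a"
    and star_star: "star (star a) = a"

record ('f, 'v) hspace =
  hcarrier :: "'v set"
  vadd :: "'v \<Rightarrow> 'v \<Rightarrow> 'v"
  vzero :: "'v"
  scale :: "'f \<Rightarrow> 'v \<Rightarrow> 'v"
  form :: "'v \<Rightarrow> 'v \<Rightarrow> 'f"

definition orthoset_of :: "('f::zero, 'v) hspace \<Rightarrow> 'v orthostruct" where
  "orthoset_of H =
     \<lparr>ocarrier = hcarrier H,
      operp = (\<lambda>u v. u \<in> hcarrier H \<and> v \<in> hcarrier H \<and> form H u v = 0),
      ozero = vzero H\<rparr>"

locale hermitian_space = star_sfield star
  for star :: "'f::division_ring \<Rightarrow> 'f" +
  fixes H :: "('f, 'v) hspace"
  assumes add_comm_group: "comm_group \<lparr>carrier = hcarrier H, mult = vadd H, one = vzero H\<rparr>"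
    and scale_closed: "u \<in> hcarrier H \<Longrightarrow> scale H a u \<in> hcarrier H"
    and scale_add_right: "\<lbrakk>u \<in> hcarrier H; v \<in> hcarrier H\<rbrakk>
      \<Longrightarrow> scale H a (vadd H u v) = vadd H (scale H a u) (scale H a v)"
    and scale_add_left: "u \<in> hcarrier H
      \<Longrightarrow> scale H (a + b) u = vadd H (scale H a u) (scale H b u)"
    and scale_scale: "u \<in> hcarrier H \<Longrightarrow> scale H (a * b) u = scale H a (scale H b u)"
    and scale_one: "u \<in> hcarrier H \<Longrightarrow> scale H 1 u = u"
    and form_linear_left: "\<lbrakk>u \<in> hcarrier H; v \<in> hcarrier H; w \<in> hcarrier H\<rbrakk>
      \<Longrightarrow> form H (vadd H (scale H a u) (scale H b v)) w = a * form H u w + b * form H v w"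
    and form_antilinear_right: "\<lbrakk>u \<in> hcarrier H; v \<in> hcarrier H; w \<in> hcarrier H\<rbrakk>
      \<Longrightarrow> form H w (vadd H (scale H a u) (scale H b v))
          = form H w u * star a + form H w v * star b"
    and form_hermitian: "\<lbrakk>u \<in> hcarrier H; v \<in> hcarrier H\<rbrakk> \<Longrightarrow> form H u v = star (form H v u)"
    and form_anisotropic: "\<lbrakk>u \<in> hcarrier H; form H u u = 0\<rbrakk> \<Longrightarrow> u = vzero H"
    and countable_orthogonal: "countable_rank (orthoset_of H)"

definition hspace_subset :: "('f, 'v) hspace \<Rightarrow> 'v set \<Rightarrow> ('f, 'v) hspace" where
  "hspace_subset H S = H\<lparr>hcarrier := S\<rparr>"

text \<open>\<open>K\<close> is (not merely isomorphic to) a subspace of \<open>H\<close>. The operations are compared on the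
  carrier of \<open>K\<close>, their values elsewhere being irrelevant.\<close>

definition is_subspace_of :: "('f::zero, 'v) hspace \<Rightarrow> ('f, 'v) hspace \<Rightarrow> bool" where
  "is_subspace_of K H \<longleftrightarrow>
     orthoclosed (orthoset_of H) (hcarrier K) \<and>
     vzero K = vzero H \<and>
     (\<forall>u\<in>hcarrier K. \<forall>v\<in>hcarrier K. vadd K u v = vadd H u v \<and> form K u v = form H u v) \<and>
     (\<forall>a. \<forall>u\<in>hcarrier K. scale K a u = scale H a u)"

text \<open>The cardinality of a maximal orthogonal set does not depend on the set.\<close>

definition has_dimension :: "('f::zero, 'v) hspace \<Rightarrow> nat \<Rightarrow> bool" where
  "has_dimension H n \<longleftrightarrow>
     (\<exists>D. orthogonal_set (orthoset_of H) D \<and>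
          (\<forall>E. orthogonal_set (orthoset_of H) E \<and> D \<subseteq> E \<longrightarrow> E = D) \<and>
          finite D \<and> card D = n)"

definition orthomodular :: "('f::zero, 'v) hspace \<Rightarrow> bool" where
  "orthomodular H \<longleftrightarrow>
     (\<forall>S. orthoclosed (orthoset_of H) S \<longrightarrow>
        hcarrier H = {vadd H s t | s t. s \<in> S \<and> t \<in> orthocomp (orthoset_of H) S})"

definition uniform :: "('f::{zero,one}, 'v) hspace \<Rightarrow> bool" where
  "uniform H \<longleftrightarrow>
     (\<forall>S. orthoclosed (orthoset_of H) S \<and> has_dimension (hspace_subset H S) 1 \<longrightarrow>
        (\<exists>u\<in>S. form H u u = 1))"

definition uniform_orthomodular_space ::
  "('f::division_ring \<Rightarrow> 'f) \<Rightarrow> ('f, 'v) hspace \<Rightarrow> bool" where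
  "uniform_orthomodular_space star H \<longleftrightarrow>
     hermitian_space star H \<and> orthomodular H \<and> uniform H"

definition linear_map :: "('f, 'v) hspace \<Rightarrow> ('f, 'w) hspace \<Rightarrow> ('v \<Rightarrow> 'w) \<Rightarrow> bool" where
  "linear_map H K \<phi> \<longleftrightarrow>
     \<phi> \<in> hcarrier H \<rightarrow>\<^sub>E hcarrier K \<and>
     (\<forall>u\<in>hcarrier H. \<forall>v\<in>hcarrier H. \<phi> (vadd H u v) = vadd K (\<phi> u) (\<phi> v)) \<and>
     (\<forall>a. \<forall>u\<in>hcarrier H. \<phi> (scale H a u) = scale K a (\<phi> u))"

definition linear_adjoint ::
  "('f, 'v) hspace \<Rightarrow> ('f, 'w) hspace \<Rightarrow> ('v \<Rightarrow> 'w) \<Rightarrow> ('w \<Rightarrow> 'v) \<Rightarrow> bool" where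
  "linear_adjoint H K \<phi> \<psi> \<longleftrightarrow>
     \<psi> \<in> hcarrier K \<rightarrow>\<^sub>E hcarrier H \<and>
     (\<forall>u\<in>hcarrier H. \<forall>v\<in>hcarrier K. form K (\<phi> u) v = form H u (\<psi> v))"

definition OMS :: "('f::division_ring \<Rightarrow> 'f) \<Rightarrow> (('f, 'v) hspace, 'v \<Rightarrow> 'v) dagcat" where
  "OMS star =
     \<lparr>Obj = {H. uniform_orthomodular_space star H},
      Hom = (\<lambda>H K. {\<phi>. linear_map H K \<phi> \<and> (\<exists>\<psi>. linear_adjoint H K \<phi> \<psi>)}),
      Idn = (\<lambda>H. \<lambda>u\<in>hcarrier H. u),
      Comp = (\<lambda>H K M \<psi> \<phi>. compose (hcarrier H) \<psi> \<phi>),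
      Dag = (\<lambda>H K \<phi>. THE \<psi>. linear_adjoint H K \<phi> \<psi>)\<rparr>"


section \<open>The assignment \<open>L\<close>\<close>

definition hspace_complement ::
  "('f::zero, 'v) hspace \<Rightarrow> ('f, 'v) hspace \<Rightarrow> ('f, 'v) hspace" where
  "hspace_complement H K = hspace_subset H (orthocomp (orthoset_of H) (hcarrier K))"

text \<open>For \<open>H\<close> and \<open>H'\<close> both containing \<open>K\<close>, and \<open>\<phi>\<close> a map from the complement of \<open>K\<close> in \<open>H\<close> to
  the complement of \<open>K\<close> in \<open>H'\<close>, this is \<open>\<phi> \<oplus> id\<close>, that is, \<open>u + w \<mapsto> \<phi> u + w\<close>.\<close>

definition oplus_id ::
  "('f::zero, 'v) hspace \<Rightarrow> ('f, 'v) hspace \<Rightarrow> ('f, 'v) hspace \<Rightarrow> ('v \<Rightarrow> 'v) \<Rightarrow> 'v \<Rightarrow> 'v" where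
  "oplus_id K H H' \<phi> =
     (\<lambda>x\<in>hcarrier H. THE y. \<exists>u\<in>hcarrier (hspace_complement H K). \<exists>w\<in>hcarrier K.
        x = vadd H u w \<and> y = vadd H' (\<phi> u) w)"

text \<open>In \<open>L_mor\<close>, the family \<open>X \<mapsto> (S X, iX X, iZ X)\<close> is the choice of biproducts of \<open>X\<close> and \<open>Z\<close>, and
  \<open>Hbar X\<close> and \<open>rbar X\<close> are the chosen spaces and orthoisomorphisms.\<close>

definition L_obj ::
  "('f::zero, 'v) hspace \<Rightarrow> ('a orthostruct \<Rightarrow> ('f, 'v) hspace) \<Rightarrow> 'a orthostruct \<Rightarrow> ('f, 'v) hspace"
where
  "L_obj HZ Hbar X = hspace_complement (Hbar X) HZ"

definition L_mor ::
  "('a orthostruct, 'a \<Rightarrow> 'a) dagcat \<Rightarrow> 'a orthostruct \<Rightarrow> ('a orthostruct \<Rightarrow> 'a orthostruct)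
   \<Rightarrow> ('a orthostruct \<Rightarrow> 'a \<Rightarrow> 'a) \<Rightarrow> ('a orthostruct \<Rightarrow> 'a \<Rightarrow> 'a)
   \<Rightarrow> ('f::zero, 'v) hspace \<Rightarrow> ('a orthostruct \<Rightarrow> ('f, 'v) hspace)
   \<Rightarrow> ('a orthostruct \<Rightarrow> 'a set \<Rightarrow> 'v set)
   \<Rightarrow> 'a orthostruct \<Rightarrow> 'a orthostruct \<Rightarrow> ('a \<Rightarrow> 'a) \<Rightarrow> 'v \<Rightarrow> 'v"
where
  "L_mor C Z S iX iZ HZ Hbar rbar X Y f =
     (THE \<phi>. linear_map (L_obj HZ Hbar X) (L_obj HZ Hbar Y) \<phi> \<and>
        (\<forall>p\<in>ocarrier (P_orthoset (S X)).
           rbar Y (P_map (S X) (S Y)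
             (biproduct_map C X Z (S X) (iX X) (iZ X) Y Z (S Y) (iX Y) (iZ Y) f (Idn C Z)) p)
           = P_map (orthoset_of (Hbar X)) (orthoset_of (Hbar Y))
               (oplus_id HZ (Hbar X) (Hbar Y) \<phi>) (rbar X p)))"

end

theory Submission
  imports Defs
begin

text \<open>
  A morphism \<open>f : X \<rightarrow> Y\<close> has the dagger \<open>f\<^sup>*\<close>, and \<open>(f \<oplus> id)\<^sup>* = f\<^sup>* \<oplus> id\<close> holds for dagger
  biproducts (\<open>biproduct_map_Dag\<close>). Transported along the coordinates \<open>rbar\<close>, the maps \<open>f \<oplus> id\<close>
  and \<open>f\<^sup>* \<oplus> id\<close> become maps between the projective spaces of \<open>Hbar X = H\<^sub>X \<oplus> K\<close> and
  \<open>Hbar Y = H\<^sub>Y \<oplus> K\<close>, where \<open>K = HZ\<close>. They are adjoint to each other, and both fix the points of \<open>K\<close>.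
  Everything rests on the fact that such a map is induced by \<open>\<phi> \<oplus> id\<close> for exactly one linear map
  \<open>\<phi> : H\<^sub>X \<rightarrow> H\<^sub>Y\<close>.

  The fixed subspace \<open>K\<close> allows an elementary argument for this. Having an adjoint, the
  map preserves collinearity, since the biorthogonal of two vectors is their span
  (\<open>in_span_of_two\<close>). So for \<open>u \<in> H\<^sub>X\<close> and \<open>0 \<noteq> w \<in> K\<close> the line of \<open>u + w\<close> is sent to the line of a
  unique vector \<open>s + w\<close> with \<open>s \<in> H\<^sub>Y\<close> (\<open>ex_lifts\<close>). If \<open>w\<close> and \<open>w'\<close> are linearly independent and \<open>s\<close>,
  \<open>s'\<close> belong to \<open>(u, w)\<close>, \<open>(u', w')\<close>, then \<open>s + s'\<close> belongs to \<open>(u + u', w + w')\<close>, by comparing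
  coefficients in \<open>K\<close> (\<open>lifts_add\<close>). With \<open>u' = 0\<close>, \<open>s' = 0\<close> it follows that \<open>s\<close> does not depend on \<open>w\<close>; so
  \<open>\<phi> u = s\<close> is well defined and additive. It is homogeneous because \<open>u + w\<close> and \<open>a u + a w\<close> lie on
  the same line (\<open>linear_map_linearisation\<close>).

  By its uniqueness, \<open>\<phi>\<close> depends functorially on \<open>f\<close>. For the dagger, let \<open>\<psi>\<close> belong to \<open>f\<^sup>*\<close>. The
  equivalence of \<open>\<phi> u + w \<bottom> v + e\<close> and \<open>u + w \<bottom> \<psi> v + e\<close>, for suitable \<open>w, e \<in> K\<close>, gives
  \<open>(\<phi> u, v) = (u, \<psi> v)\<close> (\<open>linear_adjointI\<close>). In particular \<open>\<phi>\<close> is adjointable. Finally, \<open>H\<^sub>X\<close> is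
  again a uniform orthomodular space, being a subspace of \<open>Hbar X\<close>
  (\<open>uniform_orthomodular_space_subspace\<close>).
\<close>

section \<open>Orthosets\<close>

lemma par_iff_perp: "par X x y \<longleftrightarrow> (\<forall>t\<in>ocarrier X. operp X t x \<longleftrightarrow> operp X t y)"
  unfolding par_def orthocomp_def by blast

lemma par_refl: "par X x x"
  and par_sym: "par X x y \<Longrightarrow> par X y x"
  and par_trans: "par X x y \<Longrightarrow> par X y z \<Longrightarrow> par X x z"
  unfolding par_def by simp_all

lemma par_class_eq_iff:
  assumes "x \<in> ocarrier X" "y \<in> ocarrier X"
  shows "par_class X x = par_class X y \<longleftrightarrow> par X x y"
  using assms unfolding par_class_def par_def by blast

lemma P_carrier: "ocarrier (P_orthoset X) = par_class X ` ocarrier X"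
  by (simp add: P_orthoset_def)

text \<open>A map preserving \<^const>\<open>par\<close> has a single class as the image of a class, so \<^const>\<open>P_map\<close> can
  be computed on a representative.\<close>

lemma P_map_par_class:
  assumes x: "x \<in> ocarrier X" and f: "f \<in> ocarrier X \<rightarrow> ocarrier Y"
    and f_par: "\<And>x y. \<lbrakk>x \<in> ocarrier X; y \<in> ocarrier X; par X x y\<rbrakk> \<Longrightarrow> par Y (f x) (f y)"
  shows "P_map X Y f (par_class X x) = par_class Y (f x)"
proof -
  have eq: "par_class Y (f y) = par_class Y (f x)" if "y \<in> par_class X x" for y
  proof -
    have y: "y \<in> ocarrier X" "par X x y"
      using that by (auto simp: par_class_def)
    have "par Y (f y) (f x)"
      using f_par[OF x y] by (rule par_sym)
    moreover have "f x \<in> ocarrier Y" "f y \<in> ocarrier Y"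
      using f x y(1) by auto
    ultimately show ?thesis
      by (simp add: par_class_eq_iff)
  qed
  have "x \<in> par_class X x"
    using x by (simp add: par_class_def par_refl)
  with eq have "(\<lambda>y. par_class Y (f y)) ` par_class X x = {par_class Y (f x)}"
    by blast
  with x show ?thesis
    by (simp add: P_map_def P_carrier)
qed

context orthoset
begin

lemma perp_commute: "operp X x y \<longleftrightarrow> operp X y x"
  using perp_sym by blast

lemma par_perp_iff:
  assumes "par X x x'" "par X y y'"
    and "x \<in> ocarrier X" "x' \<in> ocarrier X" "y \<in> ocarrier X" "y' \<in> ocarrier X"
  shows "operp X x y \<longleftrightarrow> operp X x' y'"
  using assms unfolding par_iff_perp by (metis perp_commute)

lemma P_perp_iff:
  assumes "x \<in> ocarrier X" "y \<in> ocarrier X"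
  shows "operp (P_orthoset X) (par_class X x) (par_class X y) \<longleftrightarrow> operp X x y"
proof
  assume "operp (P_orthoset X) (par_class X x) (par_class X y)"
  then obtain x' y' where "x' \<in> ocarrier X" "y' \<in> ocarrier X" "par_class X x = par_class X x'"
      "par_class X y = par_class X y'" "operp X x' y'"
    by (auto simp: P_orthoset_def)
  with assms show "operp X x y"
    using par_perp_iff by (metis par_class_eq_iff)
qed (use assms in \<open>auto simp: P_orthoset_def\<close>)

lemma orthoclosed_orthocomp:
  assumes "A \<subseteq> ocarrier X"
  shows "orthoclosed X (orthocomp X A)"
  using assms perp_commute unfolding orthoclosed_def orthocomp_def by blast

end

text \<open>Elements with the same orthocomplement are mapped to such elements, because the elements
  orthogonal to \<open>f x\<close> are those that the adjoint maps into \<open>{x}\<^sup>\<bottom>\<close>.\<close>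

lemma adjoint_preserves_par:
  assumes "orthoset X" "orthoset Y" "orthoset_adjoint X Y f g"
    and "f \<in> ocarrier X \<rightarrow> ocarrier Y" "g \<in> ocarrier Y \<rightarrow> ocarrier X"
    and "x \<in> ocarrier X" "y \<in> ocarrier X" "par X x y"
  shows "par Y (f x) (f y)"
proof -
  interpret X: orthoset X by fact
  interpret Y: orthoset Y by fact
  have "operp Y t (f x) \<longleftrightarrow> operp Y t (f y)" if "t \<in> ocarrier Y" for t
  proof -
    have "operp Y t (f x) \<longleftrightarrow> operp X (g t) x" "operp Y t (f y) \<longleftrightarrow> operp X (g t) y"
      using assms(3,6,7) that X.perp_commute Y.perp_commute
      unfolding orthoset_adjoint_def by blast+
    moreover have "g t \<in> ocarrier X"
      using assms(5) that by auto
    ultimately show ?thesis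
      using assms(8) by (simp add: par_iff_perp)
  qed
  then show ?thesis
    by (simp add: par_iff_perp)
qed


section \<open>Dagger biproducts\<close>

text \<open>The property that singles out the zero map. It is manifestly stable under composition and
  dagger; this transfers to \<^const>\<open>zero_map\<close> because only one map between two given objects has it.\<close>

definition factors_through_zero :: "('o, 'm) dagcat \<Rightarrow> 'o \<Rightarrow> 'o \<Rightarrow> 'm \<Rightarrow> bool" where
  "factors_through_zero C A B f \<longleftrightarrow>
     (\<exists>N g h. zero_object C N \<and> g \<in> Hom C A N \<and> h \<in> Hom C N B \<and> f = Comp C A N B h g)"

context dagger_category
begin

lemma factors_through_zero_unique:
  assumes A: "A \<in> Obj C" and B: "B \<in> Obj C"
    and f: "factors_through_zero C A B f" and f': "factors_through_zero C A B f'"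
  shows "f = f'"
proof -
  obtain N g h where N: "zero_object C N" "g \<in> Hom C A N" "h \<in> Hom C N B" "f = Comp C A N B h g"
    using f unfolding factors_through_zero_def by blast
  obtain N' g' h' where N': "zero_object C N'" "g' \<in> Hom C A N'" "h' \<in> Hom C N' B"
      "f' = Comp C A N' B h' g'"
    using f' unfolding factors_through_zero_def by blast
  have obj: "N \<in> Obj C" "N' \<in> Obj C"
    using N N' by (auto simp: zero_object_def)
  obtain n where n: "n \<in> Hom C N N'"
    using N(1) obj by (auto simp: zero_object_def)
  have "Comp C A N N' n g \<in> Hom C A N'" "Comp C N N' B h' n \<in> Hom C N B"
    using A B obj N N' n by (auto intro: Comp_hom)
  then have "Comp C A N N' n g = g'" "Comp C N N' B h' n = h"
    using N N' A B unfolding zero_object_def by blast+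
  then show ?thesis
    using Comp_assoc[OF A obj B N(2) n N'(3)] N(4) N'(4) by simp
qed

lemma factors_through_zero_zero_map:
  assumes "zero_object C N" and A: "A \<in> Obj C" and B: "B \<in> Obj C"
  shows "factors_through_zero C A B (zero_map C A B)"
proof -
  have "\<exists>!g. g \<in> Hom C A N" "\<exists>!h. h \<in> Hom C N B"
    using assms by (simp_all add: zero_object_def)
  then obtain g h where "g \<in> Hom C A N" "h \<in> Hom C N B"
    using ex1_implies_ex by metis
  with assms(1) have "factors_through_zero C A B (Comp C A N B h g)"
    unfolding factors_through_zero_def by blast
  moreover have "zero_map C A B = (THE f. factors_through_zero C A B f)"
    by (simp add: zero_map_def factors_through_zero_def)
  ultimately show ?thesis
    using factors_through_zero_unique[OF A B] by (metis the_equality)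
qed

lemma factors_through_zero_Dag:
  assumes "A \<in> Obj C" "B \<in> Obj C" "factors_through_zero C A B f"
  shows "factors_through_zero C B A (Dag C A B f)"
proof -
  obtain N g h where N: "zero_object C N" "g \<in> Hom C A N" "h \<in> Hom C N B" "f = Comp C A N B h g"
    using assms(3) unfolding factors_through_zero_def by blast
  have "N \<in> Obj C" using N(1) by (simp add: zero_object_def)
  with assms N have "Dag C A B f = Comp C B N A (Dag C A N g) (Dag C N B h)"
      "Dag C A N g \<in> Hom C N A" "Dag C N B h \<in> Hom C B N"
    by (auto simp: Dag_Comp intro: Dag_hom)
  with N(1) show ?thesis
    unfolding factors_through_zero_def by blast
qed

lemma factors_through_zero_Comp:
  assumes "A \<in> Obj C" "B \<in> Obj C" "D \<in> Obj C" "factors_through_zero C A B f" "k \<in> Hom C B D"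
  shows "factors_through_zero C A D (Comp C A B D k f)"
proof -
  obtain N g h where N: "zero_object C N" "g \<in> Hom C A N" "h \<in> Hom C N B" "f = Comp C A N B h g"
    using assms(4) unfolding factors_through_zero_def by blast
  have "N \<in> Obj C" using N(1) by (simp add: zero_object_def)
  with assms N have "Comp C A B D k f = Comp C A N D (Comp C N B D k h) g"
      "Comp C N B D k h \<in> Hom C N D"
    by (auto simp: Comp_assoc intro: Comp_hom)
  with N(1,2) show ?thesis
    unfolding factors_through_zero_def by blast
qed

lemma factors_through_zero_Comp_right:
  assumes "A \<in> Obj C" "B \<in> Obj C" "D \<in> Obj C" "factors_through_zero C B D f" "k \<in> Hom C A B"
  shows "factors_through_zero C A D (Comp C A B D f k)"
proof -
  obtain N g h where N: "zero_object C N" "g \<in> Hom C B N" "h \<in> Hom C N D" "f = Comp C B N D h g"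
    using assms(4) unfolding factors_through_zero_def by blast
  have "N \<in> Obj C" using N(1) by (simp add: zero_object_def)
  with assms N have "Comp C A B D f k = Comp C A N D h (Comp C A B N g k)"
      "Comp C A B N g k \<in> Hom C A N"
    by (auto simp: Comp_assoc intro: Comp_hom)
  with N(1,3) show ?thesis
    unfolding factors_through_zero_def by blast
qed

lemma coproduct_hom_eqI:
  assumes "coproduct C A B S i j" "D \<in> Obj C" "h \<in> Hom C S D" "k \<in> Hom C S D"
    and "A \<in> Obj C" "B \<in> Obj C"
    and "Comp C A S D h i = Comp C A S D k i" "Comp C B S D h j = Comp C B S D k j"
  shows "h = k"
proof -
  have "Comp C A S D k i \<in> Hom C A D" "Comp C B S D k j \<in> Hom C B D"
    using assms(1-6) by (auto simp: coproduct_def intro!: Comp_hom)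
  with assms show ?thesis
    unfolding coproduct_def by metis
qed

lemma biproduct_map_props:
  assumes "coproduct C A B S i j" "coproduct C A' B' S' i' j'"
    and "A \<in> Obj C" "B \<in> Obj C" "A' \<in> Obj C" "B' \<in> Obj C"
    and "f \<in> Hom C A A'" "g \<in> Hom C B B'"
  shows "biproduct_map C A B S i j A' B' S' i' j' f g \<in> Hom C S S'"
    and "Comp C A S S' (biproduct_map C A B S i j A' B' S' i' j' f g) i = Comp C A A' S' i' f"
    and "Comp C B S S' (biproduct_map C A B S i j A' B' S' i' j' f g) j = Comp C B B' S' j' g"
proof -
  have "S' \<in> Obj C" "Comp C A A' S' i' f \<in> Hom C A S'" "Comp C B B' S' j' g \<in> Hom C B S'"
    using assms by (auto simp: coproduct_def intro!: Comp_hom)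
  then have "\<exists>!h. h \<in> Hom C S S' \<and> Comp C A S S' h i = Comp C A A' S' i' f \<and>
      Comp C B S S' h j = Comp C B B' S' j' g"
    using assms(1) unfolding coproduct_def by blast
  from theI'[OF this]
  show "biproduct_map C A B S i j A' B' S' i' j' f g \<in> Hom C S S'"
    and "Comp C A S S' (biproduct_map C A B S i j A' B' S' i' j' f g) i = Comp C A A' S' i' f"
    and "Comp C B S S' (biproduct_map C A B S i j A' B' S' i' j' f g) j = Comp C B B' S' j' g"
    by (simp_all add: biproduct_map_def)
qed

lemma biproduct_map_eqI:
  assumes "coproduct C A B S i j" "coproduct C A' B' S' i' j'"
    and "A \<in> Obj C" "B \<in> Obj C" "A' \<in> Obj C" "B' \<in> Obj C"
    and "f \<in> Hom C A A'" "g \<in> Hom C B B'"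
    and "h \<in> Hom C S S'"
    and "Comp C A S S' h i = Comp C A A' S' i' f" "Comp C B S S' h j = Comp C B B' S' j' g"
  shows "biproduct_map C A B S i j A' B' S' i' j' f g = h"
proof (rule coproduct_hom_eqI[OF assms(1)])
  show "S' \<in> Obj C" using assms(2) by (simp add: coproduct_def)
qed (use assms biproduct_map_props[OF assms(1-8)] in auto)

lemma biproduct_map_Idn:
  assumes "coproduct C A B S i j" "A \<in> Obj C" "B \<in> Obj C"
  shows "biproduct_map C A B S i j A B S i j (Idn C A) (Idn C B) = Idn C S"
proof -
  have "S \<in> Obj C" "i \<in> Hom C A S" "j \<in> Hom C B S"
    using assms(1) by (auto simp: coproduct_def)
  with assms show ?thesis
    by (intro biproduct_map_eqI) (auto simp: Idn_hom Idn_Comp Comp_Idn)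
qed

lemma biproduct_map_Comp:
  assumes co: "coproduct C A B S i j" "coproduct C A' B' S' i' j'" "coproduct C A'' B'' S'' i'' j''"
    and obj: "A \<in> Obj C" "B \<in> Obj C" "A' \<in> Obj C" "B' \<in> Obj C" "A'' \<in> Obj C" "B'' \<in> Obj C"
    and hom: "f \<in> Hom C A A'" "g \<in> Hom C B B'" "f' \<in> Hom C A' A''" "g' \<in> Hom C B' B''"
  shows "biproduct_map C A B S i j A'' B'' S'' i'' j'' (Comp C A A' A'' f' f) (Comp C B B' B'' g' g)
    = Comp C S S' S'' (biproduct_map C A' B' S' i' j' A'' B'' S'' i'' j'' f' g')
        (biproduct_map C A B S i j A' B' S' i' j' f g)"
proof -
  let ?h = "biproduct_map C A B S i j A' B' S' i' j' f g"
  let ?h' = "biproduct_map C A' B' S' i' j' A'' B'' S'' i'' j'' f' g'"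
  note h = biproduct_map_props[OF co(1,2) obj(1-4) hom(1,2)]
  note h' = biproduct_map_props[OF co(2,3) obj(3-6) hom(3,4)]
  have S: "S \<in> Obj C" "S' \<in> Obj C" "S'' \<in> Obj C" "i \<in> Hom C A S" "j \<in> Hom C B S"
      "i' \<in> Hom C A' S'" "j' \<in> Hom C B' S'" "i'' \<in> Hom C A'' S''" "j'' \<in> Hom C B'' S''"
    using co by (auto simp: coproduct_def)
  have "Comp C A S S'' (Comp C S S' S'' ?h' ?h) i = Comp C A A'' S'' i'' (Comp C A A' A'' f' f)"
    using Comp_assoc[of A S S' S'' i ?h ?h'] Comp_assoc[of A A' S' S'' f i' ?h']
      Comp_assoc[of A A' A'' S'' f f' i''] h h' S obj hom by simp
  moreover
  have "Comp C B S S'' (Comp C S S' S'' ?h' ?h) j = Comp C B B'' S'' j'' (Comp C B B' B'' g' g)"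
    using Comp_assoc[of B S S' S'' j ?h ?h'] Comp_assoc[of B B' S' S'' g j' ?h']
      Comp_assoc[of B B' B'' S'' g g' j''] h h' S obj hom by simp
  ultimately show ?thesis
    using S obj hom h h' by (intro biproduct_map_eqI[OF co(1,3)]) (auto intro: Comp_hom)
qed

lemma dagger_biproductD:
  assumes "dagger_biproduct C A B S i j"
  shows "coproduct C A B S i j" "S \<in> Obj C" "i \<in> Hom C A S" "j \<in> Hom C B S"
    "Comp C A S A (Dag C A S i) i = Idn C A" "Comp C B S B (Dag C B S j) j = Idn C B"
    "Comp C A S B (Dag C B S j) i = zero_map C A B"
  using assms by (auto simp: dagger_biproduct_def coproduct_def dagger_mono_def)

text \<open>The definition of a dagger biproduct asks only that \<open>\<iota>\<^sub>B\<^sup>* \<circ> \<iota>\<^sub>A\<close> be zero; its dagger is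
  \<open>\<iota>\<^sub>A\<^sup>* \<circ> \<iota>\<^sub>B\<close>, which makes the notion symmetric in the two summands.\<close>

lemma dagger_biproduct_commute:
  assumes "zero_object C N" "A \<in> Obj C" "B \<in> Obj C" "dagger_biproduct C A B S i j"
  shows "dagger_biproduct C B A S j i"
proof -
  note d = dagger_biproductD[OF assms(4)]
  have "Dag C A B (Comp C A S B (Dag C B S j) i) = Comp C B S A (Dag C A S i) j"
    using Dag_Comp[OF assms(2) d(2) assms(3) d(3) Dag_hom[OF assms(3) d(2,4)]] d assms(2,3)
    by (simp only: Dag_Dag)
  then have "factors_through_zero C B A (Comp C B S A (Dag C A S i) j)"
    using factors_through_zero_Dag[OF assms(2,3) factors_through_zero_zero_map[OF assms(1-3)]] d(7)
    by simp
  then have "Comp C B S A (Dag C A S i) j = zero_map C B A"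
    using factors_through_zero_unique factors_through_zero_zero_map assms(1-3) by blast
  moreover have "coproduct C B A S j i"
    using d(1) unfolding coproduct_def by blast
  ultimately show ?thesis
    using assms(4) by (simp add: dagger_biproduct_def)
qed

text \<open>The two sides, \<open>\<iota>\<^sub>A\<^sub>'\<^sup>* \<circ> h\<close> and \<open>f \<circ> \<iota>\<^sub>A\<^sup>*\<close>, have the same composites with both injections: \<open>f\<close> on the
  summand \<open>A\<close>, where \<open>\<iota>\<^sup>* \<circ> \<iota> = id\<close>, and the zero map on the summand \<open>B\<close>. Here \<open>h\<close> is \<open>f \<oplus> g\<close>.\<close>

lemma Dag_inl_biproduct_map:
  assumes N: "zero_object C N"
    and b: "dagger_biproduct C A B S i j" and b': "dagger_biproduct C A' B' S' i' j'"
    and obj: "A \<in> Obj C" "B \<in> Obj C" "A' \<in> Obj C" "B' \<in> Obj C"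
    and f: "f \<in> Hom C A A'" and g: "g \<in> Hom C B B'"
    and h: "h \<in> Hom C S S'" "Comp C A S S' h i = Comp C A A' S' i' f"
      "Comp C B S S' h j = Comp C B B' S' j' g"
  shows "Comp C S S' A' (Dag C A' S' i') h = Comp C S A A' f (Dag C A S i)"
proof (rule coproduct_hom_eqI)
  note d = dagger_biproductD[OF b] and d' = dagger_biproductD[OF b']
  note c = dagger_biproductD[OF dagger_biproduct_commute[OF N obj(1,2) b]]
  note c' = dagger_biproductD[OF dagger_biproduct_commute[OF N obj(3,4) b']]
  note D = Dag_hom[OF obj(1) d(2,3)] and D' = Dag_hom[OF obj(3) d'(2,3)]
  show "coproduct C A B S i j" by (fact d)
  show "Comp C S S' A' (Dag C A' S' i') h \<in> Hom C S A'" "Comp C S A A' f (Dag C A S i) \<in> Hom C S A'"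
    using obj d d' D D' f h by (auto intro: Comp_hom)
  show "Comp C A S A' (Comp C S S' A' (Dag C A' S' i') h) i =
      Comp C A S A' (Comp C S A A' f (Dag C A S i)) i"
    using Comp_assoc[of A S S' A' i h "Dag C A' S' i'"]
      Comp_assoc[of A A' S' A' f i' "Dag C A' S' i'"]
      Comp_assoc[of A S A A' i "Dag C A S i" f] obj d d' D D' f h
    by (simp add: Comp_Idn Idn_Comp)
  have z: "factors_through_zero C B A (Comp C B S A (Dag C A S i) j)"
    using factors_through_zero_zero_map[OF N obj(2,1)] c(7) by simp
  have z': "Comp C B' S' A' (Dag C A' S' i') j' = zero_map C B' A'"
    using c'(7) .
  have "factors_through_zero C B A' (Comp C B B' A' (zero_map C B' A') g)"
    using factors_through_zero_Comp_right[OF obj(2,4,3) factors_through_zero_zero_map[OF N obj(4,3)] g] .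
  then have "factors_through_zero C B A' (Comp C B S A' (Comp C S S' A' (Dag C A' S' i') h) j)"
    using Comp_assoc[of B S S' A' j h "Dag C A' S' i'"]
      Comp_assoc[of B B' S' A' g j' "Dag C A' S' i'"] obj d d' D D' g h z'
    by simp
  moreover have "factors_through_zero C B A' (Comp C B S A' (Comp C S A A' f (Dag C A S i)) j)"
    using factors_through_zero_Comp[OF obj(2,1,3) z f]
      Comp_assoc[of B S A A' j "Dag C A S i" f] obj d d' D D' f
    by simp
  ultimately show "Comp C B S A' (Comp C S S' A' (Dag C A' S' i') h) j =
      Comp C B S A' (Comp C S A A' f (Dag C A S i)) j"
    using factors_through_zero_unique obj by blast
qed (use obj in auto)

text \<open>That \<open>(f \<oplus> g)\<^sup>* = f\<^sup>* \<oplus> g\<^sup>*\<close> is tested on the injections; by taking daggers, this becomes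
  the description of \<open>\<iota>\<^sup>* \<circ> (f \<oplus> g)\<close> for the two injections of the target.\<close>

lemma biproduct_map_Dag:
  assumes N: "zero_object C N"
    and b: "dagger_biproduct C A B S i j" and b': "dagger_biproduct C A' B' S' i' j'"
    and obj: "A \<in> Obj C" "B \<in> Obj C" "A' \<in> Obj C" "B' \<in> Obj C"
    and f: "f \<in> Hom C A A'" and g: "g \<in> Hom C B B'"
  shows "biproduct_map C A' B' S' i' j' A B S i j (Dag C A A' f) (Dag C B B' g)
    = Dag C S S' (biproduct_map C A B S i j A' B' S' i' j' f g)"
proof -
  let ?h = "biproduct_map C A B S i j A' B' S' i' j' f g"
  note d = dagger_biproductD[OF b] and d' = dagger_biproductD[OF b']
  note h = biproduct_map_props[OF d(1) d'(1) obj f g]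
  have "Comp C S S' A' (Dag C A' S' i') ?h = Comp C S A A' f (Dag C A S i)"
    by (rule Dag_inl_biproduct_map[OF N b b' obj f g h])
  then have "Dag C S A' (Comp C S S' A' (Dag C A' S' i') ?h) =
      Dag C S A' (Comp C S A A' f (Dag C A S i))"
    by simp
  then have 1: "Comp C A' S' S (Dag C S S' ?h) i' = Comp C A' A S i (Dag C A A' f)"
    using obj d d' h f by (simp add: Dag_Comp Dag_hom Dag_Dag)
  have "Comp C S S' B' (Dag C B' S' j') ?h = Comp C S B B' g (Dag C B S j)"
    using Dag_inl_biproduct_map[OF N dagger_biproduct_commute[OF N obj(1,2) b]
      dagger_biproduct_commute[OF N obj(3,4) b'] obj(2,1,4,3) g f h(1,3,2)] .
  then have "Dag C S B' (Comp C S S' B' (Dag C B' S' j') ?h) =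
      Dag C S B' (Comp C S B B' g (Dag C B S j))"
    by simp
  then have 2: "Comp C B' S' S (Dag C S S' ?h) j' = Comp C B' B S j (Dag C B B' g)"
    using obj d d' h g by (simp add: Dag_Comp Dag_hom Dag_Dag)
  show ?thesis
    using obj d d' f g h 1 2 by (intro biproduct_map_eqI) (auto intro: Dag_hom)
qed

end


section \<open>Hermitian spaces\<close>

lemma orthoset_of_simps [simp]:
  "ocarrier (orthoset_of H) = hcarrier H"
  "operp (orthoset_of H) u v \<longleftrightarrow> u \<in> hcarrier H \<and> v \<in> hcarrier H \<and> form H u v = 0"
  "ozero (orthoset_of H) = vzero H"
  by (auto simp: orthoset_of_def)

lemma hspace_subset_simps [simp]:
  "hcarrier (hspace_subset H A) = A" "vadd (hspace_subset H A) = vadd H"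
  "vzero (hspace_subset H A) = vzero H" "scale (hspace_subset H A) = scale H"
  "form (hspace_subset H A) = form H"
  by (simp_all add: hspace_subset_def)

context star_sfield
begin

lemma star_zero [simp]: "star 0 = 0"
  using star_add[of 0 0] by simp

lemma star_eq_zero_iff [simp]: "star a = 0 \<longleftrightarrow> a = 0"
  by (metis star_star star_zero)

end

context hermitian_space
begin

lemma add_monoid: "monoid \<lparr>carrier = hcarrier H, mult = vadd H, one = vzero H\<rparr>"
  using add_comm_group by (simp add: comm_group_def group_def)

lemma vzero_closed [simp]: "vzero H \<in> hcarrier H"
  using monoid.one_closed[OF add_monoid] by simp

lemma vadd_closed [simp]: "u \<in> hcarrier H \<Longrightarrow> v \<in> hcarrier H \<Longrightarrow> vadd H u v \<in> hcarrier H"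
  using monoid.m_closed[OF add_monoid, of u v] by simp

lemma vadd_assoc:
  assumes "u \<in> hcarrier H" "v \<in> hcarrier H" "w \<in> hcarrier H"
  shows "vadd H (vadd H u v) w = vadd H u (vadd H v w)"
  using monoid.m_assoc[OF add_monoid, of u v w] assms
  by simp

lemma vadd_zero [simp]:
  assumes "u \<in> hcarrier H"
  shows "vadd H u (vzero H) = u" "vadd H (vzero H) u = u"
  using monoid.r_one[OF add_monoid, of u]
    monoid.l_one[OF add_monoid, of u] assms
  by simp_all

lemmas [simp] = scale_closed

lemma form_add_left [simp]:
  assumes "u \<in> hcarrier H" "v \<in> hcarrier H" "w \<in> hcarrier H"
  shows "form H (vadd H u v) w = form H u w + form H v w"
  using form_linear_left[OF assms, of 1 1] assms by (simp add: scale_one)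

lemma form_add_right [simp]:
  assumes "u \<in> hcarrier H" "v \<in> hcarrier H" "w \<in> hcarrier H"
  shows "form H w (vadd H u v) = form H w u + form H w v"
proof -
  have "form H w (vadd H u v) = star (form H (vadd H u v) w)"
    using assms by (intro form_hermitian) auto
  also have "\<dots> = star (form H u w) + star (form H v w)"
    using assms by (simp add: star_add)
  finally show ?thesis
    using assms form_hermitian by metis
qed

lemma form_scale_left [simp]:
  assumes "u \<in> hcarrier H" "w \<in> hcarrier H"
  shows "form H (scale H a u) w = a * form H u w"
  using form_linear_left[OF assms(1,1,2), of a 0] scale_add_left[OF assms(1), of a 0] by simp

lemma form_scale_right [simp]:
  assumes "u \<in> hcarrier H" "w \<in> hcarrier H"
  shows "form H w (scale H a u) = form H w u * star a"
  using form_antilinear_right[OF assms(1,1,2), of a 0] scale_add_left[OF assms(1), of a 0] by simp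

lemma form_zero [simp]:
  assumes "w \<in> hcarrier H"
  shows "form H (vzero H) w = 0" "form H w (vzero H) = 0"
  using form_add_left[of "vzero H" "vzero H" w] form_add_right[of "vzero H" "vzero H" w] assms
  by simp_all

lemma form_eq_zero_commute:
  assumes "u \<in> hcarrier H" "v \<in> hcarrier H"
  shows "form H u v = 0 \<longleftrightarrow> form H v u = 0"
  using form_hermitian[OF assms] by simp

text \<open>Anisotropy makes the form nondegenerate. Identities between vectors are therefore proved below
  by comparing forms, which turns them into identities of scalars that the simplifier can settle.\<close>

lemma vec_eqI:
  assumes u: "u \<in> hcarrier H" and v: "v \<in> hcarrier H"
    and form_eq: "\<And>x. x \<in> hcarrier H \<Longrightarrow> form H u x = form H v x"
  shows "u = v"
proof -
  let ?d = "vadd H u (scale H (- 1) v)"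
  have "form H ?d ?d = 0"
    using u v form_eq[of ?d] by (simp del: form_add_right form_scale_right)
  then have d: "?d = vzero H"
    using u v by (intro form_anisotropic) auto
  have "form H (scale H 0 v) (scale H 0 v) = 0"
    using v by simp
  then have "scale H 0 v = vzero H"
    using v by (intro form_anisotropic) auto
  then have "vadd H (scale H (- 1) v) v = vzero H"
    using scale_add_left[OF v, of "- 1" 1] v by (simp add: scale_one)
  then have "u = vadd H ?d v"
    using u v by (simp add: vadd_assoc)
  with d v show ?thesis by simp
qed

lemma scale_zero [simp]: "u \<in> hcarrier H \<Longrightarrow> scale H 0 u = vzero H"
  "scale H a (vzero H) = vzero H"
  by (rule vec_eqI; simp)+

lemma scale_eq_vzero_iff:
  assumes "u \<in> hcarrier H"
  shows "scale H a u = vzero H \<longleftrightarrow> a = 0 \<or> u = vzero H"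
proof
  assume "scale H a u = vzero H"
  then have "a * form H u u = 0"
    using form_scale_left[OF assms assms, of a] assms by simp
  then show "a = 0 \<or> u = vzero H"
    using form_anisotropic[OF assms] by auto
qed (use assms in auto)

lemma scale_inverse_cancel:
  assumes "u \<in> hcarrier H" "a \<noteq> 0"
  shows "scale H (inverse a) (scale H a u) = u" "scale H a (scale H (inverse a) u) = u"
  using assms by (simp_all flip: scale_scale add: scale_one)

sublocale orthoset "orthoset_of H"
proof
  fix x y
  show "operp (orthoset_of H) x y \<Longrightarrow> operp (orthoset_of H) y x"
    using form_eq_zero_commute by auto
  show "operp (orthoset_of H) x x \<Longrightarrow> x = ozero (orthoset_of H)"
    using form_anisotropic by auto
qed auto

text \<open>The Gram--Schmidt step; for \<open>v = 0\<close> any scalar serves.\<close>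

lemma ex_orthogonal_reduction:
  assumes "u \<in> hcarrier H" "v \<in> hcarrier H"
  shows "\<exists>a. form H (vadd H u (scale H a v)) v = 0"
proof (cases "v = vzero H")
  case False
  then have "form H v v \<noteq> 0"
    using assms form_anisotropic by auto
  then have "form H (vadd H u (scale H (- (form H u v * inverse (form H v v))) v)) v = 0"
    using assms by (simp add: mult.assoc)
  then show ?thesis ..
qed (use assms in simp)

text \<open>The biorthogonal of two vectors is their span: subtracting from \<open>u\<close> its projections on \<open>p\<close>
  and on the part of \<open>q\<close> orthogonal to \<open>p\<close> leaves a vector \<open>t\<close> orthogonal to \<open>p\<close> and \<open>q\<close>, hence to
  \<open>u\<close>, hence to itself. This is how linear combinations are read off from orthogonality alone.\<close>

lemma in_span_of_two:
  assumes u: "u \<in> hcarrier H" and p: "p \<in> hcarrier H" and q: "q \<in> hcarrier H"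
    and perp: "\<And>t. \<lbrakk>t \<in> hcarrier H; form H t p = 0; form H t q = 0\<rbrakk> \<Longrightarrow> form H t u = 0"
  shows "\<exists>a b. u = vadd H (scale H a p) (scale H b q)"
proof -
  obtain c where c: "form H (vadd H q (scale H c p)) p = 0"
    using ex_orthogonal_reduction q p by blast
  define q' where "q' = vadd H q (scale H c p)"
  have q': "q' \<in> hcarrier H" using p q by (simp add: q'_def)
  obtain a where a: "form H (vadd H u (scale H a p)) p = 0"
    using ex_orthogonal_reduction u p by blast
  define u' where "u' = vadd H u (scale H a p)"
  have u': "u' \<in> hcarrier H" using p u by (simp add: u'_def)
  obtain b where b: "form H (vadd H u' (scale H b q')) q' = 0"
    using ex_orthogonal_reduction u' q' by blast
  define t where "t = vadd H u' (scale H b q')"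
  have t: "t \<in> hcarrier H" using u' q' by (simp add: t_def)
  have tp: "form H t p = 0"
    using u' q' p a c by (simp add: t_def u'_def[symmetric] q'_def[symmetric])
  have "form H t q' = 0"
    using b unfolding t_def .
  then have "form H t q + form H t p * star c = 0"
    using t p q by (simp add: q'_def)
  with tp have tq: "form H t q = 0" by simp
  have tu: "form H t u = 0"
    using perp t tp tq by blast
  have "form H t u' = 0" "form H t q' = 0"
    using t u p q tp tq tu by (simp_all add: u'_def q'_def)
  then have "form H t (vadd H u' (scale H b q')) = 0"
    using t u' q' by simp
  then have "t = vzero H"
    using t form_anisotropic by (simp flip: t_def)
  then have "form H t x = 0" if "x \<in> hcarrier H" for x
    using that by simp
  then have "form H u x + a * form H p x + b * (form H q x + c * form H p x) = 0"
    if "x \<in> hcarrier H" for x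
    using that u p q by (simp add: t_def u'_def q'_def)
  then have "form H u x = - (a + b * c) * form H p x + - b * form H q x" if "x \<in> hcarrier H" for x
    using that by (simp add: algebra_simps eq_neg_iff_add_eq_0)
  then have "u = vadd H (scale H (- (a + b * c)) p) (scale H (- b) q)"
    using u p q by (intro vec_eqI) auto
  then show ?thesis by blast
qed

text \<open>So the non-zero classes of a Hermitian space are its one-dimensional subspaces with \<open>0\<close>
  removed.\<close>

lemma par_iff_scale:
  assumes u: "u \<in> hcarrier H" and v: "v \<in> hcarrier H"
  shows "par (orthoset_of H) u v \<longleftrightarrow> (\<exists>a. a \<noteq> 0 \<and> u = scale H a v)"
proof
  assume par: "par (orthoset_of H) u v"
  obtain a where a: "form H (vadd H u (scale H a v)) v = 0"
    using ex_orthogonal_reduction u v by blast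
  let ?t = "vadd H u (scale H a v)"
  have "form H ?t u = 0"
    using par[unfolded par_iff_perp, THEN bspec, of ?t] a u v
    by (simp del: form_add_left form_scale_left)
  then have "form H ?t ?t = 0"
    using form_add_right[of u "scale H a v" ?t] form_scale_right[of v ?t a] a u v by simp
  then have t: "?t = vzero H"
    using u v by (intro form_anisotropic) auto
  have "u = scale H (- a) v"
  proof (rule vec_eqI)
    fix x assume x: "x \<in> hcarrier H"
    then have "form H u x + a * form H v x = 0"
      using form_zero(1)[OF x] u v unfolding t[symmetric] by simp
    then show "form H u x = form H (scale H (- a) v) x"
      using x v by (simp add: eq_neg_iff_add_eq_0)
  qed (use u v in auto)
  moreover have "v = vzero H" if "a = 0"
  proof -
    have "form H v u = 0"
      using v calculation that by simp
    then show "v = vzero H"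
      using par[unfolded par_iff_perp, THEN bspec, of v] u v form_anisotropic by simp
  qed
  ultimately have "u = scale H (if a = 0 then 1 else - a) v"
    using v by (auto simp: scale_one)
  then show "\<exists>a. a \<noteq> 0 \<and> u = scale H a v"
    by (intro exI[of _ "if a = 0 then 1 else - a"]) auto
next
  assume "\<exists>a. a \<noteq> 0 \<and> u = scale H a v"
  then show "par (orthoset_of H) u v"
    using v by (auto simp: par_iff_perp)
qed

lemma orthocomp_hspace_subset:
  assumes "orthoclosed (orthoset_of H) A" "B \<subseteq> A"
  shows "orthocomp (orthoset_of (hspace_subset H A)) B = orthocomp (orthoset_of H) B \<inter> A"
  using assms by (auto simp: orthocomp_def orthoclosed_def)

lemma orthoclosed_vadd_scale:
  assumes "orthoclosed (orthoset_of H) A"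
  shows "A \<subseteq> hcarrier H" "vzero H \<in> A" "\<lbrakk>u \<in> A; v \<in> A\<rbrakk> \<Longrightarrow> vadd H u v \<in> A"
    "u \<in> A \<Longrightarrow> scale H a u \<in> A"
proof -
  show sub: "A \<subseteq> hcarrier H"
    using assms by (simp add: orthoclosed_def)
  have A: "u \<in> A \<longleftrightarrow> u \<in> hcarrier H \<and> (\<forall>t\<in>orthocomp (orthoset_of H) A. form H u t = 0)" for u
    using assms unfolding orthoclosed_def orthocomp_def by auto
  have comp: "t \<in> hcarrier H" if "t \<in> orthocomp (orthoset_of H) A" for t
    using that by (auto simp: orthocomp_def)
  show "vzero H \<in> A" "\<lbrakk>u \<in> A; v \<in> A\<rbrakk> \<Longrightarrow> vadd H u v \<in> A" "u \<in> A \<Longrightarrow> scale H a u \<in> A"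
    using comp unfolding A[of "vzero H"] A[of "vadd H u v"] A[of "scale H a u"] A[of u] A[of v]
    by auto
qed

text \<open>Relative to \<open>A\<close>, the biorthogonal of \<open>B\<close> is \<open>(B\<^sup>\<bottom> \<inter> A)\<^sup>\<bottom> \<inter> A\<close>, an intersection of two orthoclosed
  sets.\<close>

lemma orthoclosed_in_subspace:
  assumes A: "orthoclosed (orthoset_of H) A" and B: "orthoclosed (orthoset_of (hspace_subset H A)) B"
  shows "orthoclosed (orthoset_of H) B"
proof -
  let ?c = "orthocomp (orthoset_of H)"
  have BA: "B \<subseteq> A" and AH: "A \<subseteq> hcarrier H"
    using A B by (auto simp: orthoclosed_def)
  have "B = ?c (?c B \<inter> A) \<inter> A"
    using B BA unfolding orthoclosed_def by (simp add: orthocomp_hspace_subset[OF A])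
  moreover have "?c (?c (?c (?c B \<inter> A) \<inter> A)) = ?c (?c B \<inter> A) \<inter> A"
  proof
    have "?c (?c (?c (?c B \<inter> A) \<inter> A)) \<subseteq> ?c (?c (?c (?c B \<inter> A)))"
      and "?c (?c (?c (?c B \<inter> A) \<inter> A)) \<subseteq> ?c (?c A)"
      unfolding orthocomp_def by blast+
    moreover have "?c (?c A) = A"
      using A by (simp add: orthoclosed_def)
    moreover have "?c (?c (?c (?c B \<inter> A))) = ?c (?c B \<inter> A)"
      using orthoclosed_orthocomp[of "?c B \<inter> A"] AH by (auto simp: orthoclosed_def)
    ultimately show "?c (?c (?c (?c B \<inter> A) \<inter> A)) \<subseteq> ?c (?c B \<inter> A) \<inter> A"
      by blast
    have "D \<subseteq> ?c (?c D)" if "D \<subseteq> ocarrier (orthoset_of H)" for D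
      using that perp_commute unfolding orthocomp_def by blast
    then show "?c (?c B \<inter> A) \<inter> A \<subseteq> ?c (?c (?c (?c B \<inter> A) \<inter> A))"
      using AH by (simp add: le_infI2)
  qed
  ultimately show ?thesis
    using BA AH unfolding orthoclosed_def by auto
qed

lemma hermitian_space_subspace:
  assumes A: "orthoclosed (orthoset_of H) A"
  shows "hermitian_space star (hspace_subset H A)"
proof -
  note A_simps = orthoclosed_vadd_scale[OF A]
  have H_I: "u \<in> hcarrier H" if "u \<in> A" for u
    using A_simps(1) that by blast
  have "comm_group \<lparr>carrier = A, mult = vadd H, one = vzero H\<rparr>"
  proof (rule comm_groupI, simp_all add: A_simps H_I vadd_assoc)
    fix x y assume "x \<in> A" "y \<in> A"
    then show "vadd H x y = vadd H y x"
      using H_I by (intro vec_eqI) (auto simp: add.commute)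
  next
    fix x assume x: "x \<in> A"
    then have "vadd H (scale H (- 1) x) x = vzero H"
      using H_I by (intro vec_eqI) auto
    with x A_simps show "\<exists>y\<in>A. vadd H y x = vzero H"
      by blast
  qed
  moreover have "countable_rank (orthoset_of (hspace_subset H A))"
  proof -
    have "orthogonal_set (orthoset_of H) D" if "orthogonal_set (orthoset_of (hspace_subset H A)) D" for D
      using that H_I unfolding orthogonal_set_def pairwise_def by (auto simp: proper_def)
    with countable_orthogonal show ?thesis
      unfolding countable_rank_def by blast
  qed
  ultimately show ?thesis
    using A_simps H_I
    by (intro hermitian_space.intro star_sfield_axioms hermitian_space_axioms.intro) (auto simp: scale_add_right scale_add_left scale_scale scale_one
        form_linear_left form_antilinear_right form_hermitian[symmetric] intro: form_anisotropic
        simp del: form_add_left form_add_right)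
qed

end

text \<open>Orthoclosed sets of a subspace are orthoclosed in the whole space, so they split it; for a vector
  of the subspace the second component is a difference of two vectors of the subspace and stays there.
  Uniformity passes on for the same reason.\<close>

lemma uniform_orthomodular_space_subspace:
  assumes H: "uniform_orthomodular_space star H" and A: "orthoclosed (orthoset_of H) A"
  shows "uniform_orthomodular_space star (hspace_subset H A)"
proof -
  interpret hermitian_space star H
    using H by (simp add: uniform_orthomodular_space_def)
  note A_simps = orthoclosed_vadd_scale[OF A]
  have "orthomodular (hspace_subset H A)"
    unfolding orthomodular_def
  proof (intro allI impI)
    fix B assume "orthoclosed (orthoset_of (hspace_subset H A)) B"
    then have B: "orthoclosed (orthoset_of H) B" "B \<subseteq> A"
      using orthoclosed_in_subspace[OF A] by (auto simp: orthoclosed_def)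
    have "\<exists>s t. x = vadd H s t \<and> s \<in> B \<and> t \<in> orthocomp (orthoset_of H) B \<inter> A" if x: "x \<in> A" for x
    proof -
      have "x \<in> hcarrier H" using x A_simps(1) by blast
      then obtain s t where st: "x = vadd H s t" "s \<in> B" "t \<in> orthocomp (orthoset_of H) B"
        using H B(1) unfolding uniform_orthomodular_space_def orthomodular_def by blast
      have "s \<in> hcarrier H" "t \<in> hcarrier H"
        using st B A_simps(1) by (auto simp: orthocomp_def)
      then have "t = vadd H x (scale H (- 1) s)"
        unfolding st(1) by (intro vec_eqI) auto
      moreover have "vadd H x (scale H (- 1) s) \<in> A"
        using x st(2) B(2) A_simps by blast
      ultimately show ?thesis
        using st by blast
    qed
    moreover have "vadd H s t \<in> A" if "s \<in> B" "t \<in> A" for s t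
      using that B(2) A_simps(3) by blast
    ultimately show "hcarrier (hspace_subset H A) = {vadd (hspace_subset H A) s t |s t.
        s \<in> B \<and> t \<in> orthocomp (orthoset_of (hspace_subset H A)) B}"
      unfolding orthocomp_hspace_subset[OF A B(2)] by auto
  qed
  moreover have "uniform (hspace_subset H A)"
    using H orthoclosed_in_subspace[OF A]
    unfolding uniform_orthomodular_space_def uniform_def by (simp add: hspace_subset_def)
  ultimately show ?thesis
    using hermitian_space_subspace[OF A] by (simp add: uniform_orthomodular_space_def)
qed


section \<open>The dagger category of orthomodular spaces\<close>

lemma (in hermitian_space) vec_eqI_right:
  assumes "u \<in> hcarrier H" "v \<in> hcarrier H"
    and "\<And>x. x \<in> hcarrier H \<Longrightarrow> form H x u = form H x v"
  shows "u = v"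
  using assms by (intro vec_eqI) (metis form_hermitian)+

lemma linear_map_closed: "linear_map H K \<phi> \<Longrightarrow> u \<in> hcarrier H \<Longrightarrow> \<phi> u \<in> hcarrier K"
  by (auto simp: linear_map_def)

lemma linear_adjoint_closed: "linear_adjoint H K \<phi> \<psi> \<Longrightarrow> v \<in> hcarrier K \<Longrightarrow> \<psi> v \<in> hcarrier H"
  by (auto simp: linear_adjoint_def)

lemma linear_adjoint_form:
  "\<lbrakk>linear_adjoint H K \<phi> \<psi>; u \<in> hcarrier H; v \<in> hcarrier K\<rbrakk> \<Longrightarrow> form K (\<phi> u) v = form H u (\<psi> v)"
  by (auto simp: linear_adjoint_def)

lemma linear_adjoint_unique:
  assumes "hermitian_space star H" "linear_adjoint H K \<phi> \<psi>" "linear_adjoint H K \<phi> \<psi>'"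
  shows "\<psi> = \<psi>'"
proof (rule PiE_ext)
  show "\<psi> \<in> hcarrier K \<rightarrow>\<^sub>E hcarrier H" "\<psi>' \<in> hcarrier K \<rightarrow>\<^sub>E hcarrier H"
    using assms(2,3) by (auto simp: linear_adjoint_def)
  fix v assume "v \<in> hcarrier K"
  with assms(2,3) show "\<psi> v = \<psi>' v"
    by (intro hermitian_space.vec_eqI_right[OF assms(1)])
      (auto simp: linear_adjoint_closed simp flip: linear_adjoint_form)
qed

lemma linear_adjoint_sym:
  assumes H: "hermitian_space star H" and K: "hermitian_space star K"
    and \<phi>: "linear_map H K \<phi>" and adj: "linear_adjoint H K \<phi> \<psi>"
  shows "linear_adjoint K H \<psi> \<phi>"
  unfolding linear_adjoint_def
proof (intro conjI ballI)
  interpret H: hermitian_space star H by fact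
  interpret K: hermitian_space star K by fact
  show "\<phi> \<in> hcarrier H \<rightarrow>\<^sub>E hcarrier K"
    using \<phi> by (simp add: linear_map_def)
  fix v u assume uv: "v \<in> hcarrier K" "u \<in> hcarrier H"
  then have closed: "\<phi> u \<in> hcarrier K" "\<psi> v \<in> hcarrier H"
    using linear_map_closed[OF \<phi>] linear_adjoint_closed[OF adj] by auto
  have "form H (\<psi> v) u = star (form K (\<phi> u) v)"
    using H.form_hermitian[OF closed(2) uv(2)] linear_adjoint_form[OF adj uv(2,1)] by simp
  also have "\<dots> = form K v (\<phi> u)"
    using K.form_hermitian[OF uv(1) closed(1)] by simp
  finally show "form H (\<psi> v) u = form K v (\<phi> u)" .
qed

text \<open>For adjointable maps between Hermitian spaces, the adjoint is linear by nondegeneracy; this is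
  what makes it a morphism again.\<close>

lemma linear_adjoint_linear:
  assumes H: "hermitian_space star H" and K: "hermitian_space star K"
    and \<phi>: "linear_map H K \<phi>" and adj: "linear_adjoint H K \<phi> \<psi>"
  shows "linear_map K H \<psi>"
  unfolding linear_map_def
proof (intro conjI ballI allI)
  interpret H: hermitian_space star H by fact
  interpret K: hermitian_space star K by fact
  show "\<psi> \<in> hcarrier K \<rightarrow>\<^sub>E hcarrier H"
    using adj by (simp add: linear_adjoint_def)
  note simps = linear_adjoint_closed[OF adj] linear_map_closed[OF \<phi>]
    linear_adjoint_form[OF adj, symmetric]
  fix u v assume "u \<in> hcarrier K" "v \<in> hcarrier K"
  then show "\<psi> (vadd K u v) = vadd H (\<psi> u) (\<psi> v)"
    by (intro H.vec_eqI_right) (auto simp: simps)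
next
  interpret H: hermitian_space star H by fact
  interpret K: hermitian_space star K by fact
  note simps = linear_adjoint_closed[OF adj] linear_map_closed[OF \<phi>]
    linear_adjoint_form[OF adj, symmetric]
  fix a u assume "u \<in> hcarrier K"
  then show "\<psi> (scale K a u) = scale H a (\<psi> u)"
    by (intro H.vec_eqI_right) (auto simp: simps)
qed

lemma linear_map_id:
  assumes "hermitian_space star H"
  shows "linear_map H H (\<lambda>u\<in>hcarrier H. u)"
proof -
  interpret hermitian_space star H by fact
  show ?thesis by (auto simp: linear_map_def)
qed

lemma linear_map_compose:
  assumes "hermitian_space star H" "linear_map H K \<phi>" "linear_map K M \<psi>"
  shows "linear_map H M (compose (hcarrier H) \<psi> \<phi>)"
proof -
  interpret hermitian_space star H by fact
  show ?thesis
    using assms(2,3) linear_map_closed[OF assms(2)] linear_map_closed[OF assms(3)]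
    unfolding linear_map_def by (auto simp: compose_def)
qed

lemma linear_adjoint_id: "linear_adjoint H H (\<lambda>u\<in>hcarrier H. u) (\<lambda>u\<in>hcarrier H. u)"
  by (auto simp: linear_adjoint_def)

lemma linear_adjoint_compose:
  assumes "linear_map H K \<phi>" "linear_adjoint H K \<phi> \<phi>'" "linear_adjoint K M \<psi> \<psi>'"
  shows "linear_adjoint H M (compose (hcarrier H) \<psi> \<phi>) (compose (hcarrier M) \<phi>' \<psi>')"
  using assms linear_map_closed[OF assms(1)] linear_adjoint_closed[OF assms(2)]
    linear_adjoint_closed[OF assms(3)]
  unfolding linear_adjoint_def by (auto simp: compose_def)

lemma Dag_OMS:
  assumes "hermitian_space star H" "linear_adjoint H K \<phi> \<psi>"
  shows "Dag (OMS star) H K \<phi> = \<psi>"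
  using assms by (auto simp: OMS_def intro!: the_equality linear_adjoint_unique)

lemma OMS_simps:
  "Obj (OMS star) = {H. uniform_orthomodular_space star H}"
  "Hom (OMS star) H K = {\<phi>. linear_map H K \<phi> \<and> (\<exists>\<psi>. linear_adjoint H K \<phi> \<psi>)}"
  "Idn (OMS star) H = (\<lambda>u\<in>hcarrier H. u)"
  "Comp (OMS star) H K M \<psi> \<phi> = compose (hcarrier H) \<psi> \<phi>"
  by (simp_all add: OMS_def)

lemma OMS_hermitian: "H \<in> Obj (OMS star) \<Longrightarrow> hermitian_space star H"
  by (simp add: OMS_simps uniform_orthomodular_space_def)

lemma OMS_dagger_category: "dagger_category (OMS star)"
proof
  fix A B D E :: "('a, 'b) hspace" and f g h
  assume "A \<in> Obj (OMS star)"
  then have A: "hermitian_space star A" by (rule OMS_hermitian)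
  show "Idn (OMS star) A \<in> Hom (OMS star) A A"
    using linear_map_id[OF A] linear_adjoint_id by (auto simp: OMS_simps)
  show "Dag (OMS star) A A (Idn (OMS star) A) = Idn (OMS star) A"
    using Dag_OMS[OF A linear_adjoint_id] by (simp add: OMS_simps)
  assume "B \<in> Obj (OMS star)"
  then have B: "hermitian_space star B" by (rule OMS_hermitian)
  assume f: "f \<in> Hom (OMS star) A B"
  then have lin_f: "linear_map A B f"
    by (simp add: OMS_simps)
  have ext_f: "f \<in> hcarrier A \<rightarrow>\<^sub>E hcarrier B"
    using lin_f by (simp add: linear_map_def)
  obtain f' where f': "linear_adjoint A B f f'"
    using f by (auto simp: OMS_simps)
  note Dag_f = Dag_OMS[OF A f']
  note f'_sym = linear_adjoint_sym[OF A B lin_f f']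
  show "Comp (OMS star) A A B f (Idn (OMS star) A) = f"
    using ext_f compose_Id[of f "hcarrier A" "hcarrier B"] by (simp add: OMS_simps PiE_def)
  show "Comp (OMS star) A B B (Idn (OMS star) B) f = f"
    using ext_f Id_compose[of f "hcarrier A" "hcarrier B"] by (simp add: OMS_simps PiE_def)
  show "Dag (OMS star) A B f \<in> Hom (OMS star) B A"
    using linear_adjoint_linear[OF A B lin_f f'] f'_sym by (auto simp: OMS_simps Dag_f)
  show "Dag (OMS star) B A (Dag (OMS star) A B f) = f"
    using Dag_OMS[OF B f'_sym] by (simp add: Dag_f)
  assume "D \<in> Obj (OMS star)"
  assume g: "g \<in> Hom (OMS star) B D"
  then have lin_g: "linear_map B D g"
    by (simp add: OMS_simps)
  obtain g' where g': "linear_adjoint B D g g'"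
    using g by (auto simp: OMS_simps)
  note comp = linear_adjoint_compose[OF lin_f f' g']
  show "Comp (OMS star) A B D g f \<in> Hom (OMS star) A D"
    using linear_map_compose[OF A lin_f lin_g] comp by (auto simp: OMS_simps)
  show "Dag (OMS star) A D (Comp (OMS star) A B D g f) =
      Comp (OMS star) D B A (Dag (OMS star) A B f) (Dag (OMS star) B D g)"
    using Dag_OMS[OF A comp] by (simp add: OMS_simps Dag_f Dag_OMS[OF B g'])
  show "Comp (OMS star) A D E h (Comp (OMS star) A B D g f) =
      Comp (OMS star) A B E (Comp (OMS star) B D E h g) f"
    using ext_f compose_assoc[of f "hcarrier A" "hcarrier B"] by (simp add: OMS_simps PiE_def)
qed


section \<open>Spaces containing a common subspace\<close>

text \<open>The decomposition \<open>H = K \<oplus> K\<^sup>\<bottom>\<close>. The record \<open>K\<close> has operations of its own, which agree with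
  those of \<open>H\<close> on its carrier; sums and multiples of elements of \<open>K\<close> are rewritten to the operations
  of \<open>K\<close>, so that computations in two spaces containing \<open>K\<close> have a common normal form.\<close>

locale hermitian_extension = hermitian_space star H + sub: hermitian_space star K
  for star :: "'f::division_ring \<Rightarrow> 'f" and K H :: "('f, 'v) hspace" +
  assumes subspace: "is_subspace_of K H"
    and splits: "hcarrier H = {vadd H s t | s t. s \<in> hcarrier K \<and>
      t \<in> orthocomp (orthoset_of H) (hcarrier K)}"
begin

lemma sub_closed [simp]: "w \<in> hcarrier K \<Longrightarrow> w \<in> hcarrier H"
  using subspace by (auto simp: is_subspace_of_def orthoclosed_def)

lemma sub_ops [simp]:
  "\<lbrakk>u \<in> hcarrier K; v \<in> hcarrier K\<rbrakk> \<Longrightarrow> vadd H u v = vadd K u v"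
  "\<lbrakk>u \<in> hcarrier K; v \<in> hcarrier K\<rbrakk> \<Longrightarrow> form H u v = form K u v"
  "u \<in> hcarrier K \<Longrightarrow> scale H a u = scale K a u"
  using subspace by (auto simp: is_subspace_of_def)

lemma sub_zero: "vzero K = vzero H"
  using subspace by (simp add: is_subspace_of_def)

lemma form_sub_ops [simp]:
  assumes "x \<in> hcarrier H" "w \<in> hcarrier K"
  shows "form H (scale K a w) x = a * form H w x"
    and "v \<in> hcarrier K \<Longrightarrow> form H (vadd K v w) x = form H v x + form H w x"
  using assms form_scale_left[of w x a] form_add_left[of v w x] by simp_all

abbreviation "compl \<equiv> hspace_complement H K"

lemma compl_simps [simp]:
  "vadd compl = vadd H" "scale compl = scale H" "form compl = form H" "vzero compl = vzero H"
  by (simp_all add: hspace_complement_def)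

lemma mem_compl_iff:
  "u \<in> hcarrier compl \<longleftrightarrow> u \<in> hcarrier H \<and> (\<forall>w\<in>hcarrier K. form H u w = 0)"
  by (auto simp: hspace_complement_def orthocomp_def)

lemma compl_closed [simp]: "u \<in> hcarrier compl \<Longrightarrow> u \<in> hcarrier H"
  by (simp add: mem_compl_iff)

lemma form_compl_sub [simp]:
  assumes "u \<in> hcarrier compl" "w \<in> hcarrier K"
  shows "form H u w = 0" "form H w u = 0"
  using assms form_eq_zero_commute[of u w] by (auto simp: mem_compl_iff)

lemma compl_ops_closed [simp]:
  "\<lbrakk>u \<in> hcarrier compl; v \<in> hcarrier compl\<rbrakk> \<Longrightarrow> vadd H u v \<in> hcarrier compl"
  "u \<in> hcarrier compl \<Longrightarrow> scale H a u \<in> hcarrier compl"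
  "vzero H \<in> hcarrier compl"
  unfolding mem_compl_iff by simp_all

lemma split_vector:
  assumes "x \<in> hcarrier H"
  obtains u w where "u \<in> hcarrier compl" "w \<in> hcarrier K" "x = vadd H u w"
proof -
  obtain s t where st: "x = vadd H s t" "s \<in> hcarrier K" "t \<in> orthocomp (orthoset_of H) (hcarrier K)"
    using assms splits by auto
  then have t: "t \<in> hcarrier compl"
    by (simp add: hspace_complement_def)
  moreover have "x = vadd H t s"
    unfolding st(1) using st(2) t by (intro vec_eqI) (auto simp: add.commute)
  ultimately show ?thesis
    using st(2) that by blast
qed

text \<open>The two components are orthogonal, so pairing with vectors of \<open>K\<close> recovers \<open>w\<close>.\<close>

lemma split_unique:
  assumes "u \<in> hcarrier compl" "u' \<in> hcarrier compl" "w \<in> hcarrier K" "w' \<in> hcarrier K"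
    and eq: "vadd H u w = vadd H u' w'"
  shows "u = u'" "w = w'"
proof -
  have inner: "form H u x + form H w x = form H u' x + form H w' x" if "x \<in> hcarrier H" for x
    using assms(1-4) that arg_cong[OF eq, of "\<lambda>y. form H y x"] by simp
  show "w = w'"
  proof (rule sub.vec_eqI)
    show "form K w x = form K w' x" if "x \<in> hcarrier K" for x
      using assms(1-4) inner[of x] that by simp
  qed (use assms in auto)
  with inner show "u = u'"
    using assms(1-4) by (intro vec_eqI) auto
qed

text \<open>A line not contained in \<open>K\<^sup>\<bottom>\<close> meets the translate \<open>K\<^sup>\<bottom> + w\<close>, where \<open>w \<noteq> 0\<close>, in at most one
  point. Fixing the component \<open>w\<close> therefore turns classes of vectors into vectors.\<close>

lemma par_affine_eqI:
  assumes s: "s \<in> hcarrier compl" "s' \<in> hcarrier compl"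
    and w: "w \<in> hcarrier K" "w \<noteq> vzero K"
    and par: "par (orthoset_of H) (vadd H s w) (vadd H s' w)"
  shows "s = s'"
proof -
  obtain a where "vadd H s w = scale H a (vadd H s' w)"
    using par s w by (auto simp: par_iff_scale)
  then have "vadd H s w = vadd H (scale H a s') (scale K a w)"
    using s w scale_add_right by simp
  note split = split_unique[OF _ _ _ _ this]
  have 1: "s = scale H a s'" and 2: "w = scale K a w"
    using split s w by simp_all
  have "form K w w = a * form K w w"
    using sub.form_scale_left[OF w(1,1), of a] 2 by simp
  moreover have "form K w w \<noteq> 0"
    using w sub.form_anisotropic by blast
  ultimately have "a = 1" by simp
  with 1 show ?thesis
    using s scale_one by simp
qed

lemma hermitian_compl: "hermitian_space star compl"
  unfolding hspace_complement_def
  by (intro hermitian_space_subspace orthoclosed_orthocomp) auto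

end

lemma hermitian_extensionI:
  assumes "uniform_orthomodular_space star K" "uniform_orthomodular_space star H"
    "is_subspace_of K H"
  shows "hermitian_extension star K H"
  using assms
  unfolding hermitian_extension_def hermitian_extension_axioms_def uniform_orthomodular_space_def
  by (simp add: orthomodular_def is_subspace_of_def)

locale extension_pair = dom: hermitian_extension star K H + cod: hermitian_extension star K H'
  for star :: "'f::division_ring \<Rightarrow> 'f" and K H H' :: "('f, 'v) hspace"
begin

lemma oplus_id_vadd:
  assumes "u \<in> hcarrier dom.compl" "w \<in> hcarrier K"
  shows "oplus_id K H H' \<phi> (vadd H u w) = vadd H' (\<phi> u) w"
proof -
  have "(THE y. \<exists>u'\<in>hcarrier dom.compl. \<exists>w'\<in>hcarrier K. vadd H u w = vadd H u' w' \<and>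
      y = vadd H' (\<phi> u') w') = vadd H' (\<phi> u) w"
    using assms dom.split_unique by (intro the_equality) blast+
  with assms show ?thesis
    by (simp add: oplus_id_def)
qed

lemma oplus_id_closed:
  assumes "linear_map dom.compl cod.compl \<phi>" "x \<in> hcarrier H"
  shows "oplus_id K H H' \<phi> x \<in> hcarrier H'"
proof -
  obtain u w where "u \<in> hcarrier dom.compl" "w \<in> hcarrier K" "x = vadd H u w"
    using dom.split_vector assms(2) .
  with linear_map_closed[OF assms(1)] show ?thesis
    by (simp add: oplus_id_vadd)
qed

lemma oplus_id_scale:
  assumes \<phi>: "linear_map dom.compl cod.compl \<phi>" and "x \<in> hcarrier H"
  shows "oplus_id K H H' \<phi> (scale H a x) = scale H' a (oplus_id K H H' \<phi> x)"
proof -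
  obtain u w where x: "u \<in> hcarrier dom.compl" "w \<in> hcarrier K" "x = vadd H u w"
    using dom.split_vector assms(2) .
  have \<phi>u: "\<phi> u \<in> hcarrier cod.compl" "\<phi> (scale H a u) = scale H' a (\<phi> u)"
    using x(1) linear_map_closed[OF \<phi>] \<phi> by (auto simp: linear_map_def)
  have "scale H a x = vadd H (scale H a u) (scale K a w)"
    using x dom.scale_add_right by simp
  then have "oplus_id K H H' \<phi> (scale H a x) = vadd H' (scale H' a (\<phi> u)) (scale K a w)"
    using x \<phi>u by (simp add: oplus_id_vadd)
  also have "\<dots> = scale H' a (vadd H' (\<phi> u) w)"
    using x \<phi>u cod.scale_add_right by simp
  finally show ?thesis
    using x by (simp add: oplus_id_vadd)
qed

lemma oplus_id_par:
  assumes "linear_map dom.compl cod.compl \<phi>" "x \<in> hcarrier H" "y \<in> hcarrier H"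
    and "par (orthoset_of H) x y"
  shows "par (orthoset_of H') (oplus_id K H H' \<phi> x) (oplus_id K H H' \<phi> y)"
  using assms oplus_id_scale[OF assms(1)] oplus_id_closed[OF assms(1)]
  by (auto simp: dom.par_iff_scale cod.par_iff_scale)

lemma linear_map_eqI:
  assumes \<phi>: "linear_map dom.compl cod.compl \<phi>" and \<phi>': "linear_map dom.compl cod.compl \<phi>'"
    and e: "e \<in> hcarrier K" "e \<noteq> vzero K"
    and par: "\<And>x. x \<in> hcarrier H \<Longrightarrow>
      par (orthoset_of H') (oplus_id K H H' \<phi> x) (oplus_id K H H' \<phi>' x)"
  shows "\<phi> = \<phi>'"
proof (rule PiE_ext)
  show "\<phi> \<in> hcarrier dom.compl \<rightarrow>\<^sub>E hcarrier cod.compl" "\<phi>' \<in> hcarrier dom.compl \<rightarrow>\<^sub>E hcarrier cod.compl"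
    using \<phi> \<phi>' by (simp_all add: linear_map_def)
  fix u assume u: "u \<in> hcarrier dom.compl"
  have closed: "\<phi> u \<in> hcarrier cod.compl" "\<phi>' u \<in> hcarrier cod.compl"
    using u linear_map_closed[OF \<phi>] linear_map_closed[OF \<phi>'] by auto
  have "par (orthoset_of H') (vadd H' (\<phi> u) e) (vadd H' (\<phi>' u) e)"
    using par[of "vadd H u e"] u e by (simp add: oplus_id_vadd)
  then show "\<phi> u = \<phi>' u"
    using cod.par_affine_eqI closed e by blast
qed

text \<open>Orthogonality determines the values of the forms: given \<open>u\<close> and \<open>v\<close>, the vector \<open>w\<close> is chosen
  in \<open>K\<close> such that \<open>(w, e) = - (\<phi> u, v)\<close>. Then \<open>\<phi> u + w \<bottom> v + e\<close>, hence \<open>u + w \<bottom> \<psi> v + e\<close>, and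
  this says that \<open>(u, \<psi> v) = - (w, e)\<close>.\<close>

lemma linear_adjointI:
  assumes \<phi>: "linear_map dom.compl cod.compl \<phi>" and \<psi>: "linear_map cod.compl dom.compl \<psi>"
    and e: "e \<in> hcarrier K" "e \<noteq> vzero K"
    and perp: "\<And>x y. \<lbrakk>x \<in> hcarrier H; y \<in> hcarrier H'\<rbrakk> \<Longrightarrow>
      form H' (oplus_id K H H' \<phi> x) y = 0 \<longleftrightarrow> form H x (oplus_id K H' H \<psi> y) = 0"
  shows "linear_adjoint dom.compl cod.compl \<phi> \<psi>"
  unfolding linear_adjoint_def
proof (intro conjI ballI)
  interpret flip: extension_pair star K H' H ..
  show "\<psi> \<in> hcarrier cod.compl \<rightarrow>\<^sub>E hcarrier dom.compl"
    using \<psi> by (simp add: linear_map_def)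
  fix u v assume uv: "u \<in> hcarrier dom.compl" "v \<in> hcarrier cod.compl"
  have closed: "\<phi> u \<in> hcarrier cod.compl" "\<psi> v \<in> hcarrier dom.compl"
    using uv linear_map_closed[OF \<phi>] linear_map_closed[OF \<psi>] by auto
  define w where "w = scale K (- (form H' (\<phi> u) v * inverse (form K e e))) e"
  have w: "w \<in> hcarrier K"
    using e by (simp add: w_def)
  have ee: "form K e e \<noteq> 0"
    using e dom.sub.form_anisotropic by blast
  have we: "form K w e = - form H' (\<phi> u) v"
    using e ee by (simp add: w_def mult.assoc)
  have "form H' (vadd H' (\<phi> u) w) (vadd H' v e) = 0"
    using uv closed w e we by simp
  then have "form H (vadd H u w) (vadd H (\<psi> v) e) = 0"
    using perp[of "vadd H u w" "vadd H' v e"] uv w e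
    by (simp add: oplus_id_vadd flip.oplus_id_vadd)
  then have "form H u (\<psi> v) + form K w e = 0"
    using uv closed w e by simp
  with we show "form cod.compl (\<phi> u) v = form dom.compl u (\<psi> v)"
    by simp
qed

end


section \<open>Linearisation of adjoint pairs\<close>

text \<open>The maps \<open>G\<close> and \<open>G'\<close> are to be thought of as maps between projective spaces, each class being
  given by some representative: all hypotheses depend on classes only. The vectors \<open>d\<^sub>1\<close> and \<open>d\<^sub>2\<close>
  witness that \<open>K\<close> has a line to spare, which allows lines of \<open>K\<close> to be compared with one another.\<close>

locale fixing_adjoint_pair = extension_pair star K H H'
  for star :: "'f::division_ring \<Rightarrow> 'f" and K H H' :: "('f, 'v) hspace" +
  fixes G :: "'v \<Rightarrow> 'v" and G' :: "'v \<Rightarrow> 'v" and d\<^sub>1 d\<^sub>2 :: 'v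
  assumes G_closed [simp]: "x \<in> hcarrier H \<Longrightarrow> G x \<in> hcarrier H'"
    and G'_closed [simp]: "y \<in> hcarrier H' \<Longrightarrow> G' y \<in> hcarrier H"
    and adjoint: "\<lbrakk>x \<in> hcarrier H; y \<in> hcarrier H'\<rbrakk> \<Longrightarrow> form H' (G x) y = 0 \<longleftrightarrow> form H x (G' y) = 0"
    and G_fixes: "w \<in> hcarrier K \<Longrightarrow> par (orthoset_of H') (G w) w"
    and G'_fixes: "w \<in> hcarrier K \<Longrightarrow> par (orthoset_of H) (G' w) w"
    and d [simp]: "d\<^sub>1 \<in> hcarrier K" "d\<^sub>2 \<in> hcarrier K"
    and d_nonzero: "d\<^sub>1 \<noteq> vzero K" "d\<^sub>2 \<noteq> vzero K"
    and d_perp: "form K d\<^sub>1 d\<^sub>2 = 0"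
begin

lemma G_par:
  assumes "x \<in> hcarrier H" "y \<in> hcarrier H" "par (orthoset_of H) x y"
  shows "par (orthoset_of H') (G x) (G y)"
  using adjoint_preserves_par[of "orthoset_of H" "orthoset_of H'" G G' x y] assms adjoint
    dom.orthoset_axioms cod.orthoset_axioms
  by (simp add: orthoset_adjoint_def)

text \<open>\<open>G\<close> preserves collinearity because the biorthogonal of two vectors is their span.\<close>

lemma G_combination:
  assumes p: "p \<in> hcarrier H" and q: "q \<in> hcarrier H"
    and x: "x = vadd H (scale H a p) (scale H b q)"
  shows "\<exists>a' b'. G x = vadd H' (scale H' a' (G p)) (scale H' b' (G q))"
proof (rule cod.in_span_of_two)
  fix t assume t: "t \<in> hcarrier H'" "form H' t (G p) = 0" "form H' t (G q) = 0"
  have "form H p (G' t) = 0" "form H q (G' t) = 0"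
    using t p q adjoint cod.form_eq_zero_commute by simp_all
  then have "form H x (G' t) = 0"
    using t(1) p q by (simp add: x)
  then show "form H' t (G x) = 0"
    using t(1) p q x adjoint cod.form_eq_zero_commute by simp
qed (use p q x in simp_all)

lemma G_compl:
  assumes "u \<in> hcarrier dom.compl"
  shows "G u \<in> hcarrier cod.compl"
  unfolding cod.mem_compl_iff
proof (intro conjI ballI)
  fix w assume w: "w \<in> hcarrier K"
  then obtain a where "G' w = scale K a w"
    using G'_fixes[of w] by (auto simp: dom.par_iff_scale)
  then have "form H u (G' w) = 0"
    using assms w by simp
  then show "form H' (G u) w = 0"
    using assms w adjoint by simp
qed (use assms in simp)

text \<open>For \<open>w \<noteq> 0\<close>, \<open>s + w\<close> is the point at which the image line of \<open>u + w\<close> meets the translate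
  \<open>K\<^sup>\<bottom> + w\<close>.\<close>

definition lifts :: "'v \<Rightarrow> 'v \<Rightarrow> 'v \<Rightarrow> bool" where
  "lifts u w s \<longleftrightarrow> s \<in> hcarrier cod.compl \<and> par (orthoset_of H') (vadd H' s w) (G (vadd H u w))"

text \<open>The image of \<open>u + w\<close> lies on the line through \<open>G u \<in> K\<^sup>\<bottom>\<close> and \<open>w\<close>. Its coefficient at \<open>w\<close> is not
  zero because \<open>u + w\<close> is not orthogonal to \<open>w\<close> and \<open>G'\<close> fixes the class of \<open>w\<close>; it can be
  normalised to \<open>1\<close>.\<close>

lemma ex_lifts:
  assumes u: "u \<in> hcarrier dom.compl" and w: "w \<in> hcarrier K" "w \<noteq> vzero K"
  shows "\<exists>s. lifts u w s"
proof -
  obtain a b where ab: "G (vadd H u w) = vadd H' (scale H' a (G u)) (scale H' b (G w))"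
    using G_combination[of u w "vadd H u w" 1 1] u w by (auto simp: dom.scale_one dom.sub.scale_one)
  obtain c where c: "c \<noteq> 0" "G w = scale K c w"
    using G_fixes[of w] w by (auto simp: cod.par_iff_scale)
  obtain c' where c': "c' \<noteq> 0" "G' w = scale K c' w"
    using G'_fixes[of w] w by (auto simp: dom.par_iff_scale)
  define y where "y = scale H' a (G u)"
  define k where "k = b * c"
  have y: "y \<in> hcarrier cod.compl"
    using G_compl[OF u] by (simp add: y_def)
  have G: "G (vadd H u w) = vadd H' y (scale K k w)"
    using ab c w by (simp add: y_def k_def dom.sub.scale_scale)
  have "form H (vadd H u w) (G' w) = form K w w * star c'"
    using u w c' by simp
  moreover have "form K w w \<noteq> 0"
    using w dom.sub.form_anisotropic by blast
  ultimately have "form H (vadd H u w) (G' w) \<noteq> 0"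
    using c' dom.star_eq_zero_iff by simp
  then have "form H' (G (vadd H u w)) w \<noteq> 0"
    using adjoint u w by simp
  then have k: "k \<noteq> 0"
    using y w by (auto simp: G)
  have "vadd H' (scale H' (inverse k) y) w = scale H' (inverse k) (G (vadd H u w))"
    using y w k by (simp add: G cod.scale_add_right dom.sub.scale_inverse_cancel)
  then have "par (orthoset_of H') (vadd H' (scale H' (inverse k) y) w) (G (vadd H u w))"
    using k y u w by (auto simp: cod.par_iff_scale intro!: exI[of _ "inverse k"])
  then have "lifts u w (scale H' (inverse k) y)"
    using y by (simp add: lifts_def)
  then show ?thesis ..
qed

lemma lifts_zero:
  assumes "w \<in> hcarrier K"
  shows "lifts (vzero H) w (vzero H')"
  using assms par_sym[OF G_fixes] by (simp add: lifts_def)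

lemma lifts_scale:
  assumes u: "u \<in> hcarrier dom.compl" and w: "w \<in> hcarrier K" and a: "a \<noteq> 0"
    and lifts: "lifts u w s"
  shows "lifts (scale H a u) (scale K a w) (scale H' a s)"
proof -
  have s: "s \<in> hcarrier cod.compl" and s_par: "par (orthoset_of H') (vadd H' s w) (G (vadd H u w))"
    using lifts by (auto simp: lifts_def)
  have "vadd H (scale H a u) (scale K a w) = scale H a (vadd H u w)"
    using u w dom.scale_add_right by simp
  then have "par (orthoset_of H) (vadd H u w) (vadd H (scale H a u) (scale K a w))"
    using a u w dom.par_iff_scale[of "scale H a (vadd H u w)" "vadd H u w"] par_sym by auto
  then have 1: "par (orthoset_of H') (G (vadd H u w)) (G (vadd H (scale H a u) (scale K a w)))"
    using u w by (intro G_par) auto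
  have "vadd H' (scale H' a s) (scale K a w) = scale H' a (vadd H' s w)"
    using s w cod.scale_add_right by simp
  then have 2: "par (orthoset_of H') (vadd H' (scale H' a s) (scale K a w)) (vadd H' s w)"
    using a s w by (auto simp: cod.par_iff_scale)
  show ?thesis
    using s par_trans[OF 2 par_trans[OF s_par 1]] by (simp add: lifts_def)
qed

definition independent :: "'v \<Rightarrow> 'v \<Rightarrow> bool" where
  "independent w w' \<longleftrightarrow>
     (\<forall>a b. vadd K (scale K a w) (scale K b w') = vzero K \<longrightarrow> a = 0 \<and> b = 0)"

text \<open>The key step. Since \<open>(u + u') + (w + w') = (u + w) + (u' + w')\<close>, the lift \<open>t\<close> satisfies
  \<open>t + (w + w') = \<alpha> (s + w) + \<beta> (s' + w')\<close>. Comparing the components in \<open>K\<close>, independence forces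
  \<open>\<alpha> = \<beta> = 1\<close>, and then the components in \<open>K\<^sup>\<bottom>\<close> give \<open>t = s + s'\<close>.\<close>

lemma lifts_add:
  assumes u: "u \<in> hcarrier dom.compl" "u' \<in> hcarrier dom.compl"
    and w: "w \<in> hcarrier K" "w' \<in> hcarrier K" "independent w w'"
    and lifts: "lifts u w s" "lifts u' w' s'"
  shows "lifts (vadd H u u') (vadd K w w') (vadd H' s s')"
proof -
  have s: "s \<in> hcarrier cod.compl" "s' \<in> hcarrier cod.compl"
    using lifts by (auto simp: lifts_def)
  have "vadd K w w' \<noteq> vzero K"
    using w unfolding independent_def by (metis dom.sub.scale_one zero_neq_one)
  then obtain t where t: "lifts (vadd H u u') (vadd K w w') t"
    using ex_lifts[of "vadd H u u'" "vadd K w w'"] u w by auto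
  then have tc: "t \<in> hcarrier cod.compl"
    by (simp add: lifts_def)
  obtain c where c: "G (vadd H u w) = scale H' c (vadd H' s w)"
    using par_sym[OF conjunct2[OF lifts(1)[unfolded lifts_def]]] u w s
    by (auto simp: cod.par_iff_scale)
  obtain c' where c': "G (vadd H u' w') = scale H' c' (vadd H' s' w')"
    using par_sym[OF conjunct2[OF lifts(2)[unfolded lifts_def]]] u w s
    by (auto simp: cod.par_iff_scale)
  have "vadd H (vadd H u u') (vadd K w w') = vadd H (vadd H u w) (vadd H u' w')"
  proof (rule dom.vec_eqI)
    fix x assume "x \<in> hcarrier H"
    then show "form H (vadd H (vadd H u u') (vadd K w w')) x = form H (vadd H (vadd H u w) (vadd H u' w')) x"
      using u w by (simp add: algebra_simps)
  qed (use u w in auto)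
  then obtain a b where "G (vadd H (vadd H u u') (vadd K w w')) =
      vadd H' (scale H' a (G (vadd H u w))) (scale H' b (G (vadd H u' w')))"
    using G_combination[of "vadd H u w" "vadd H u' w'" "vadd H (vadd H u u') (vadd K w w')" 1 1] u w
    by (auto simp: dom.scale_one)
  moreover obtain k where "vadd H' t (vadd K w w') = scale H' k (G (vadd H (vadd H u u') (vadd K w w')))"
    using t u w tc unfolding lifts_def by (auto simp: cod.par_iff_scale)
  ultimately have eq: "vadd H' t (vadd K w w') =
      scale H' k (vadd H' (scale H' a (scale H' c (vadd H' s w))) (scale H' b (scale H' c' (vadd H' s' w'))))"
    by (simp only: c c')
  define \<alpha> \<beta> where "\<alpha> = k * a * c" and "\<beta> = k * b * c'"
  have "vadd H' t (vadd K w w') =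
      vadd H' (vadd H' (scale H' \<alpha> s) (scale H' \<beta> s')) (vadd K (scale K \<alpha> w) (scale K \<beta> w'))"
  proof (rule cod.vec_eqI)
    fix x assume "x \<in> hcarrier H'"
    then show "form H' (vadd H' t (vadd K w w')) x =
      form H' (vadd H' (vadd H' (scale H' \<alpha> s) (scale H' \<beta> s')) (vadd K (scale K \<alpha> w) (scale K \<beta> w'))) x"
      unfolding eq using s w
      by (simp add: algebra_simps \<alpha>_def \<beta>_def)
  qed (use s w tc in auto)
  note split = cod.split_unique[OF _ _ _ _ this]
  have t_eq: "t = vadd H' (scale H' \<alpha> s) (scale H' \<beta> s')"
    and w_eq: "vadd K w w' = vadd K (scale K \<alpha> w) (scale K \<beta> w')"
    using split s w tc by auto
  have "vadd K (scale K (\<alpha> - 1) w) (scale K (\<beta> - 1) w') = vzero K"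
  proof (rule dom.sub.vec_eqI)
    fix x assume x: "x \<in> hcarrier K"
    have "form K w x + form K w' x = \<alpha> * form K w x + \<beta> * form K w' x"
      using arg_cong[OF w_eq, of "\<lambda>y. form K y x"] w x by simp
    then show "form K (vadd K (scale K (\<alpha> - 1) w) (scale K (\<beta> - 1) w')) x = form K (vzero K) x"
      using w x by (simp add: algebra_simps)
  qed (use w in auto)
  then have "\<alpha> - 1 = 0 \<and> \<beta> - 1 = 0"
    using w(3) unfolding independent_def by blast
  then have "\<alpha> = 1" "\<beta> = 1"
    by simp_all
  then have "t = vadd H' s s'"
    using t_eq s by (simp add: cod.scale_one)
  with t show ?thesis by simp
qed

lemma independent_d: "independent d\<^sub>1 d\<^sub>2"
  unfolding independent_def
proof (intro allI impI)
  fix a b assume eq: "vadd K (scale K a d\<^sub>1) (scale K b d\<^sub>2) = vzero K"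
  have d_perp': "form K d\<^sub>2 d\<^sub>1 = 0"
    using d_perp dom.sub.form_eq_zero_commute by simp
  have dd: "form K d\<^sub>1 d\<^sub>1 \<noteq> 0" "form K d\<^sub>2 d\<^sub>2 \<noteq> 0"
    using d d_nonzero dom.sub.form_anisotropic by blast+
  have "a * form K d\<^sub>1 d\<^sub>1 = 0" "b * form K d\<^sub>2 d\<^sub>2 = 0"
    using arg_cong[OF eq, of "\<lambda>y. form K y d\<^sub>1"] arg_cong[OF eq, of "\<lambda>y. form K y d\<^sub>2"] d_perp d_perp'
    by simp_all
  with dd show "a = 0 \<and> b = 0" by simp
qed

lemma independent_change:
  assumes w: "w \<in> hcarrier K" "w' \<in> hcarrier K" and ind: "independent w w'"
  shows "independent w (vadd K w' (scale K (- 1) w))"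
  unfolding independent_def
proof (intro allI impI)
  fix a b assume "vadd K (scale K a w) (scale K b (vadd K w' (scale K (- 1) w))) = vzero K"
  moreover have "vadd K (scale K a w) (scale K b (vadd K w' (scale K (- 1) w))) =
      vadd K (scale K (a - b) w) (scale K b w')"
    using w by (intro dom.sub.vec_eqI) (auto simp: algebra_simps)
  ultimately have "a - b = 0 \<and> b = 0"
    using ind unfolding independent_def by metis
  then show "a = 0 \<and> b = 0" by simp
qed

text \<open>This is additivity with second summand \<open>0 + (w' - w)\<close>, whose lift is \<open>0\<close>.\<close>

lemma lifts_change:
  assumes u: "u \<in> hcarrier dom.compl" and w: "w \<in> hcarrier K" "w' \<in> hcarrier K" "independent w w'"
    and lifts: "lifts u w s"
  shows "lifts u w' s"
proof -
  let ?v = "vadd K w' (scale K (- 1) w)"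
  have s: "s \<in> hcarrier cod.compl"
    using lifts by (simp add: lifts_def)
  have v: "vadd K w ?v = w'"
    using w by (intro dom.sub.vec_eqI) (auto simp: algebra_simps)
  have "lifts (vadd H u (vzero H)) (vadd K w ?v) (vadd H' s (vzero H'))"
    using u w lifts independent_change[OF w] by (intro lifts_add lifts_zero) auto
  then show ?thesis
    using u s v by simp
qed

text \<open>If \<open>w\<close> and \<open>d\<^sub>2\<close> are dependent, then \<open>w\<close> is a non-zero multiple of \<open>d\<^sub>2\<close>, and \<open>d\<^sub>2\<close> is independent
  of \<open>d\<^sub>1\<close>.\<close>

lemma independent_d_cases:
  assumes w: "w \<in> hcarrier K" "w \<noteq> vzero K"
  shows "independent d\<^sub>1 w \<or> independent d\<^sub>2 w"
proof (rule disjCI)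
  assume "\<not> independent d\<^sub>2 w"
  then obtain a b where eq: "vadd K (scale K a d\<^sub>2) (scale K b w) = vzero K" and "a \<noteq> 0 \<or> b \<noteq> 0"
    unfolding independent_def by auto
  then have b: "b \<noteq> 0"
    using d_nonzero(2) dom.sub.scale_eq_vzero_iff[of "d\<^sub>2" a] w(1) by auto
  define c where "c = - (inverse b * a)"
  have w_eq: "w = scale K c d\<^sub>2"
  proof (rule dom.sub.vec_eqI)
    fix x assume x: "x \<in> hcarrier K"
    have "a * form K d\<^sub>2 x + b * form K w x = 0"
      using arg_cong[OF eq, of "\<lambda>y. form K y x"] w(1) x by simp
    then have "b * form K w x = - (a * form K d\<^sub>2 x)"
      by (simp add: eq_neg_iff_add_eq_0 add.commute)
    then have "inverse b * (b * form K w x) = inverse b * (- (a * form K d\<^sub>2 x))"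
      by simp
    then have "form K w x = - (inverse b * (a * form K d\<^sub>2 x))"
      using b by (simp flip: mult.assoc)
    then show "form K w x = form K (scale K c d\<^sub>2) x"
      using x by (simp add: c_def mult.assoc)
  qed (use w in auto)
  then have c: "c \<noteq> 0"
    using w(2) by auto
  show "independent d\<^sub>1 w"
    unfolding independent_def
  proof (intro allI impI)
    fix a' b' assume "vadd K (scale K a' d\<^sub>1) (scale K b' w) = vzero K"
    then have "vadd K (scale K a' d\<^sub>1) (scale K (b' * c) d\<^sub>2) = vzero K"
      using dom.sub.scale_scale[of "d\<^sub>2" b' c] by (simp add: w_eq)
    then show "a' = 0 \<and> b' = 0"
      using independent_d c unfolding independent_def by fastforce
  qed
qed

text \<open>Lifting over \<open>d\<^sub>1\<close>; by \<open>lifts_linearisation\<close> below, any other non-zero vector of \<open>K\<close> gives the same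
  map.\<close>

definition linearisation :: "'v \<Rightarrow> 'v" where
  "linearisation = (\<lambda>u\<in>hcarrier dom.compl. SOME s. lifts u d\<^sub>1 s)"

text \<open>A vector \<open>w\<close> is independent of \<open>d\<^sub>1\<close> or of \<open>d\<^sub>2\<close>, and \<open>d\<^sub>1\<close>, \<open>d\<^sub>2\<close> are independent of each
  other; so the value at \<open>d\<^sub>1\<close> can be carried over to \<open>w\<close>, if necessary by way of \<open>d\<^sub>2\<close>.\<close>

lemma lifts_linearisation:
  assumes u: "u \<in> hcarrier dom.compl" and w: "w \<in> hcarrier K" "w \<noteq> vzero K"
  shows "lifts u w (linearisation u)"
proof -
  have d\<^sub>1: "lifts u d\<^sub>1 (linearisation u)"
    using ex_lifts[OF u d(1) d_nonzero(1)] someI_ex u by (simp add: linearisation_def)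
  then have "lifts u d\<^sub>2 (linearisation u)"
    using lifts_change[OF u d independent_d] by simp
  with d\<^sub>1 show ?thesis
    using independent_d_cases[OF w] lifts_change[OF u _ w(1)] d by blast
qed

lemma lifts_unique:
  assumes w: "w \<in> hcarrier K" "w \<noteq> vzero K" and lifts: "lifts u w s" "lifts u w s'"
  shows "s = s'"
proof (rule cod.par_affine_eqI[OF _ _ w])
  show "s \<in> hcarrier cod.compl" "s' \<in> hcarrier cod.compl"
    using lifts by (simp_all add: lifts_def)
  show "par (orthoset_of H') (vadd H' s w) (vadd H' s' w)"
    using lifts unfolding lifts_def by (meson par_sym par_trans)
qed

text \<open>Additivity comes from lifting over \<open>d\<^sub>1 + d\<^sub>2\<close>. Homogeneity comes from lifting \<open>a u\<close> over \<open>a d\<^sub>1\<close>,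
  as \<open>a u + a d\<^sub>1\<close> and \<open>u + d\<^sub>1\<close> span the same line: no automorphism of the
  scalars can enter.\<close>

lemma linear_map_linearisation: "linear_map dom.compl cod.compl linearisation"
  unfolding linear_map_def
proof (intro conjI ballI allI)
  note lift = lifts_linearisation
  have closed: "linearisation u \<in> hcarrier cod.compl" if "u \<in> hcarrier dom.compl" for u
    using lift[OF that d(1) d_nonzero(1)] by (simp add: lifts_def)
  then show "linearisation \<in> hcarrier dom.compl \<rightarrow>\<^sub>E hcarrier cod.compl"
    by (auto simp: linearisation_def)
  fix u assume u: "u \<in> hcarrier dom.compl"
  {
    fix v assume v: "v \<in> hcarrier dom.compl"
    have "vadd K d\<^sub>1 d\<^sub>2 \<noteq> vzero K"
      using independent_d unfolding independent_def by (metis d dom.sub.scale_one zero_neq_one)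
    then have "linearisation (vadd H u v) = vadd H' (linearisation u) (linearisation v)"
      using u v lift d d_nonzero independent_d
      by (intro lifts_unique[of "vadd K d\<^sub>1 d\<^sub>2" "vadd H u v"] lifts_add) auto
    then show "linearisation (vadd dom.compl u v) = vadd cod.compl (linearisation u) (linearisation v)"
      by simp
  }
  fix a
  show "linearisation (scale dom.compl a u) = scale cod.compl a (linearisation u)"
  proof (cases "a = 0")
    case True
    have "linearisation (vzero H) = vzero H'"
      using lift lifts_zero d(1) d_nonzero(1) by (intro lifts_unique[of "d\<^sub>1" "vzero H"]) auto
    then show ?thesis
      using True u closed by simp
  next
    case False
    then have "scale K a d\<^sub>1 \<noteq> vzero K"
      using d_nonzero(1) dom.sub.scale_eq_vzero_iff[of "d\<^sub>1" a] by simp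
    then have "linearisation (scale H a u) = scale H' a (linearisation u)"
      using u lift d d_nonzero False
      by (intro lifts_unique[of "scale K a d\<^sub>1" "scale H a u"] lifts_scale) auto
    then show ?thesis by simp
  qed
qed

text \<open>The case of a zero component in \<open>K\<close>, where there is no translate to intersect with. Collinearity
  of \<open>u\<close>, \<open>d\<^sub>1\<close> and \<open>u + d\<^sub>1\<close> is used twice, to show that each of \<open>\<phi> u\<close> and \<open>G u\<close> is a multiple of the
  other; so one of them vanishes only if the other does.\<close>

lemma linearisation_par_compl:
  assumes u: "u \<in> hcarrier dom.compl"
  shows "par (orthoset_of H') (linearisation u) (G u)"
proof -
  let ?s = "linearisation u"
  have "lifts u d\<^sub>1 ?s"
    using lifts_linearisation[OF u d(1) d_nonzero(1)] .
  then have s: "?s \<in> hcarrier cod.compl"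
    and lift: "par (orthoset_of H') (vadd H' ?s d\<^sub>1) (G (vadd H u d\<^sub>1))"
    by (auto simp: lifts_def)
  have Gu: "G u \<in> hcarrier cod.compl"
    using G_compl u by simp
  obtain c where c: "G d\<^sub>1 = scale K c d\<^sub>1"
    using G_fixes[of "d\<^sub>1"] by (auto simp: cod.par_iff_scale)
  obtain k where k: "vadd H' ?s d\<^sub>1 = scale H' k (G (vadd H u d\<^sub>1))"
    using lift s u by (auto simp: cod.par_iff_scale)
  obtain l where l: "G (vadd H u d\<^sub>1) = scale H' l (vadd H' ?s d\<^sub>1)"
    using par_sym[OF lift] s u by (auto simp: cod.par_iff_scale)
  obtain a b where ab: "G (vadd H u d\<^sub>1) = vadd H' (scale H' a (G u)) (scale H' b (G d\<^sub>1))"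
    using G_combination[of u "d\<^sub>1" "vadd H u d\<^sub>1" 1 1] u by (auto simp: dom.scale_one dom.sub.scale_one)
  have "vadd H' ?s d\<^sub>1 = vadd H' (scale H' (k * a) (G u)) (scale K (k * b * c) d\<^sub>1)"
    unfolding k ab c using Gu
    by (intro cod.vec_eqI) (auto simp: algebra_simps)
  note split = cod.split_unique(1)[OF _ _ _ _ this]
  have s_eq: "?s = scale H' (k * a) (G u)"
    using split s Gu by simp
  have "u = vadd H (scale H 1 (vadd H u d\<^sub>1)) (scale H (- 1) d\<^sub>1)"
    using u by (intro dom.vec_eqI) auto
  then obtain a' b' where a'b': "G u = vadd H' (scale H' a' (G (vadd H u d\<^sub>1))) (scale H' b' (G d\<^sub>1))"
    using G_combination[of "vadd H u d\<^sub>1" "d\<^sub>1"] u by (metis d(1) dom.compl_closed dom.sub_closed dom.vadd_closed)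
  have "vadd H' (G u) (vzero K) = vadd H' (scale H' (a' * l) ?s) (scale K (a' * l + b' * c) d\<^sub>1)"
    unfolding a'b' l c using s
    by (intro cod.vec_eqI) (auto simp: algebra_simps cod.sub_zero)
  note split = cod.split_unique(1)[OF _ _ _ _ this]
  have "G u = scale H' (a' * l) ?s"
    using split s Gu by simp
  with s_eq show ?thesis
    using s Gu by (auto simp: par_iff_perp)
qed

lemma linearisation_par:
  assumes "x \<in> hcarrier H"
  shows "par (orthoset_of H') (oplus_id K H H' linearisation x) (G x)"
proof -
  obtain u w where x: "u \<in> hcarrier dom.compl" "w \<in> hcarrier K" "x = vadd H u w"
    using dom.split_vector assms .
  have s: "linearisation u \<in> hcarrier cod.compl"
    using linear_map_closed[OF linear_map_linearisation] x(1) .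
  show ?thesis
  proof (cases "w = vzero K")
    case True
    with x s linearisation_par_compl[OF x(1)] show ?thesis
      using oplus_id_vadd[of u w linearisation]
      by (metis cod.sub_zero cod.vadd_zero(1) dom.sub_zero dom.vadd_zero(1) cod.compl_closed
        dom.compl_closed)
  next
    case False
    with x lifts_linearisation show ?thesis
      by (simp add: oplus_id_vadd lifts_def)
  qed
qed

end


section \<open>The functor\<close>

context orthoset_dagger_category
begin

lemma hom_closed: "\<lbrakk>X \<in> Obj C; Y \<in> Obj C; f \<in> Hom C X Y; x \<in> ocarrier X\<rbrakk> \<Longrightarrow> f x \<in> ocarrier Y"
  using hom_maps by blast

lemma hom_preserves_par:
  assumes "X \<in> Obj C" "Y \<in> Obj C" "f \<in> Hom C X Y"
    and "x \<in> ocarrier X" "y \<in> ocarrier X" "par X x y"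
  shows "par Y (f x) (f y)"
  using assms obj_orthoset Dag_adjoint Dag_hom hom_closed
  by (intro adjoint_preserves_par[of X Y f "Dag C X Y f"]) auto

end

text \<open>The data from which \<open>L\<close> is built, together with a zero object \<open>N\<close> and two orthogonal non-zero vectors of
  \<open>HZ\<close>, from which the linearisation starts.\<close>

locale coordinatisation = orthoset_dagger_category C
  for C :: "('a orthostruct, 'a \<Rightarrow> 'a) dagcat" +
  fixes star :: "'f::division_ring \<Rightarrow> 'f"
    and N Z :: "'a orthostruct"
    and HZ :: "('f, 'v) hspace"
    and r :: "'a set \<Rightarrow> 'v set"
    and S :: "'a orthostruct \<Rightarrow> 'a orthostruct"
    and iX iZ :: "'a orthostruct \<Rightarrow> 'a \<Rightarrow> 'a"
    and Hbar :: "'a orthostruct \<Rightarrow> ('f, 'v) hspace"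
    and rbar :: "'a orthostruct \<Rightarrow> 'a set \<Rightarrow> 'v set"
    and d\<^sub>1 d\<^sub>2 :: 'v
  assumes zero: "zero_object C N"
    and Z: "Z \<in> Obj C"
    and HZ: "uniform_orthomodular_space star HZ"
    and d: "d\<^sub>1 \<in> hcarrier HZ" "d\<^sub>2 \<in> hcarrier HZ" "d\<^sub>1 \<noteq> vzero HZ" "d\<^sub>2 \<noteq> vzero HZ"
      "form HZ d\<^sub>1 d\<^sub>2 = 0"
    and r: "orthoisomorphism (P_orthoset Z) (P_orthoset (orthoset_of HZ)) r"
    and S: "\<And>X. X \<in> Obj C \<Longrightarrow> dagger_biproduct C X Z (S X) (iX X) (iZ X)"
    and Hbar: "\<And>X. X \<in> Obj C \<Longrightarrow> uniform_orthomodular_space star (Hbar X)"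
    and Hbar_sub: "\<And>X. X \<in> Obj C \<Longrightarrow> is_subspace_of HZ (Hbar X)"
    and rbar: "\<And>X. X \<in> Obj C \<Longrightarrow>
        orthoisomorphism (P_orthoset (S X)) (P_orthoset (orthoset_of (Hbar X))) (rbar X)"
    and rbar_r: "\<And>X p. X \<in> Obj C \<Longrightarrow> p \<in> ocarrier (P_orthoset Z) \<Longrightarrow>
        rbar X (P_map Z (S X) (iZ X) p)
        = P_map (orthoset_of HZ) (orthoset_of (Hbar X)) (\<lambda>w\<in>hcarrier HZ. w) (r p)"
begin

lemma extension: "X \<in> Obj C \<Longrightarrow> hermitian_extension star HZ (Hbar X)"
  using HZ Hbar Hbar_sub by (intro hermitian_extensionI)

lemma pair: "\<lbrakk>X \<in> Obj C; Y \<in> Obj C\<rbrakk> \<Longrightarrow> extension_pair star HZ (Hbar X) (Hbar Y)"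
  by (simp add: extension_pair_def extension)

lemmas S_props = dagger_biproductD(1-4)[OF S]

text \<open>\<open>v\<close> is a homogeneous coordinate vector of \<open>x\<close>. Working with this relation instead of \<open>rbar\<close>
  replaces maps between sets of classes by maps between elements, and its relational composition
  makes functoriality of the linearisation immediate.\<close>

definition corr :: "'a orthostruct \<Rightarrow> 'v \<Rightarrow> 'a \<Rightarrow> bool" where
  "corr X v x \<longleftrightarrow> v \<in> hcarrier (Hbar X) \<and> x \<in> ocarrier (S X) \<and>
     rbar X (par_class (S X) x) = par_class (orthoset_of (Hbar X)) v"

lemma corrD: "corr X v x \<Longrightarrow> v \<in> hcarrier (Hbar X)" "corr X v x \<Longrightarrow> x \<in> ocarrier (S X)"
  by (simp_all add: corr_def)

lemma ex_corr_right:
  assumes "X \<in> Obj C" "v \<in> hcarrier (Hbar X)"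
  shows "\<exists>x. corr X v x"
proof -
  have "par_class (orthoset_of (Hbar X)) v \<in> rbar X ` ocarrier (P_orthoset (S X))"
    using rbar[OF assms(1)] assms(2) by (simp add: orthoisomorphism_def bij_betw_def P_carrier)
  with assms(2) show ?thesis
    by (auto simp: P_carrier corr_def)
qed

lemma ex_corr_left:
  assumes "X \<in> Obj C" "x \<in> ocarrier (S X)"
  shows "\<exists>v. corr X v x"
proof -
  have "rbar X (par_class (S X) x) \<in> ocarrier (P_orthoset (orthoset_of (Hbar X)))"
    using rbar[OF assms(1)] assms(2) unfolding orthoisomorphism_def bij_betw_def P_carrier by blast
  with assms(2) show ?thesis
    by (auto simp: P_carrier corr_def)
qed

lemma corr_perp:
  assumes X: "X \<in> Obj C" and corr: "corr X v x" "corr X v' x'"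
  shows "form (Hbar X) v v' = 0 \<longleftrightarrow> operp (S X) x x'"
proof -
  interpret hermitian_extension star HZ "Hbar X"
    using extension[OF X] .
  interpret S: orthoset "S X"
    using obj_orthoset S_props[OF X] by blast
  have "operp (P_orthoset (S X)) (par_class (S X) x) (par_class (S X) x') \<longleftrightarrow>
      operp (P_orthoset (orthoset_of (Hbar X))) (par_class (orthoset_of (Hbar X)) v)
        (par_class (orthoset_of (Hbar X)) v')"
    using rbar[OF X] corr by (auto simp: orthoisomorphism_def P_carrier corr_def)
  then show ?thesis
    using corr by (simp add: corr_def P_perp_iff S.P_perp_iff)
qed

lemma corr_par_left:
  assumes "corr X v x" "v' \<in> hcarrier (Hbar X)"
  shows "corr X v' x \<longleftrightarrow> par (orthoset_of (Hbar X)) v v'"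
  using assms par_class_eq_iff[of v "orthoset_of (Hbar X)" v'] by (auto simp: corr_def)

lemma corr_par_right:
  assumes X: "X \<in> Obj C" and corr: "corr X v x" "x' \<in> ocarrier (S X)"
  shows "corr X v x' \<longleftrightarrow> par (S X) x x'"
proof -
  have "rbar X (par_class (S X) x) = rbar X (par_class (S X) x') \<longleftrightarrow>
      par_class (S X) x = par_class (S X) x'"
    using rbar[OF X] corr
    by (intro inj_on_eq_iff[of _ "ocarrier (P_orthoset (S X))"])
      (auto simp: orthoisomorphism_def bij_betw_def P_carrier corr_def)
  with corr show ?thesis
    by (auto simp: corr_def par_class_eq_iff)
qed

lemma corr_iZ:
  assumes X: "X \<in> Obj C" and z: "z \<in> ocarrier Z" and w: "w \<in> hcarrier HZ"
    and rz: "r (par_class Z z) = par_class (orthoset_of HZ) w"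
  shows "corr X w (iZ X z)"
proof -
  interpret hermitian_extension star HZ "Hbar X"
    using extension[OF X] .
  note SX = S_props[OF X]
  have "P_map Z (S X) (iZ X) (par_class Z z) = par_class (S X) (iZ X z)"
    using hom_closed[OF Z SX(2,4)] hom_preserves_par[OF Z SX(2,4)] z
    by (intro P_map_par_class) auto
  moreover have "P_map (orthoset_of HZ) (orthoset_of (Hbar X)) (\<lambda>w\<in>hcarrier HZ. w)
      (par_class (orthoset_of HZ) w) = par_class (orthoset_of (Hbar X)) ((\<lambda>w\<in>hcarrier HZ. w) w)"
    using w by (intro P_map_par_class) (auto simp: sub.par_iff_scale par_iff_scale)
  ultimately show ?thesis
    using rbar_r[OF X, of "par_class Z z"] z w rz hom_closed[OF Z SX(2,4)]
    by (simp add: corr_def P_carrier)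
qed

lemma ex_r_preimage:
  assumes "w \<in> hcarrier HZ"
  shows "\<exists>z\<in>ocarrier Z. r (par_class Z z) = par_class (orthoset_of HZ) w"
proof -
  have "par_class (orthoset_of HZ) w \<in> r ` ocarrier (P_orthoset Z)"
    using r assms by (simp add: orthoisomorphism_def bij_betw_def P_carrier)
  then show ?thesis
    by (auto simp: P_carrier)
qed

definition plus_id :: "'a orthostruct \<Rightarrow> 'a orthostruct \<Rightarrow> ('a \<Rightarrow> 'a) \<Rightarrow> 'a \<Rightarrow> 'a" where
  "plus_id X Y f = biproduct_map C X Z (S X) (iX X) (iZ X) Y Z (S Y) (iX Y) (iZ Y) f (Idn C Z)"

lemma plus_id_hom: "\<lbrakk>X \<in> Obj C; Y \<in> Obj C; f \<in> Hom C X Y\<rbrakk> \<Longrightarrow> plus_id X Y f \<in> Hom C (S X) (S Y)"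
  unfolding plus_id_def using S_props Z Idn_hom by (intro biproduct_map_props) auto

lemma plus_id_iZ:
  assumes XY: "X \<in> Obj C" "Y \<in> Obj C" "f \<in> Hom C X Y" and z: "z \<in> ocarrier Z"
  shows "plus_id X Y f (iZ X z) = iZ Y z"
proof -
  have "Comp C Z (S X) (S Y) (plus_id X Y f) (iZ X) = iZ Y"
    using biproduct_map_props(3)[OF S_props(1)[OF XY(1)] S_props(1)[OF XY(2)] XY(1) Z XY(2) Z XY(3)
      Idn_hom[OF Z]] S_props[OF XY(2)] Z by (simp add: plus_id_def Comp_Idn)
  then have "compose (ocarrier Z) (plus_id X Y f) (iZ X) = iZ Y"
    using Comp_map[OF Z _ _ _ plus_id_hom[OF XY]] S_props XY by simp
  with z show ?thesis
    by (metis compose_eq)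
qed

lemma plus_id_Idn: "X \<in> Obj C \<Longrightarrow> plus_id X X (Idn C X) = Idn C (S X)"
  unfolding plus_id_def using S_props Z by (intro biproduct_map_Idn) auto

lemma plus_id_Comp:
  assumes "X \<in> Obj C" "Y \<in> Obj C" "W \<in> Obj C" "f \<in> Hom C X Y" "g \<in> Hom C Y W"
  shows "plus_id X W (Comp C X Y W g f) = Comp C (S X) (S Y) (S W) (plus_id Y W g) (plus_id X Y f)"
  using biproduct_map_Comp[OF S_props(1) S_props(1) S_props(1) _ Z _ Z _ Z _ Idn_hom _ Idn_hom,
      of X Y W f g] assms Z Comp_Idn[OF Z Z Idn_hom]
  by (simp add: plus_id_def)

lemma plus_id_Dag:
  assumes "X \<in> Obj C" "Y \<in> Obj C" "f \<in> Hom C X Y"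
  shows "plus_id Y X (Dag C X Y f) = Dag C (S X) (S Y) (plus_id X Y f)"
  using biproduct_map_Dag[OF zero S S _ Z _ Z _ Idn_hom, of X Y f] assms Z
  by (simp add: plus_id_def Dag_Idn)

lemma plus_id_adjoint:
  assumes "X \<in> Obj C" "Y \<in> Obj C" "f \<in> Hom C X Y" "x \<in> ocarrier (S X)" "y \<in> ocarrier (S Y)"
  shows "operp (S Y) (plus_id X Y f x) y \<longleftrightarrow> operp (S X) x (plus_id Y X (Dag C X Y f) y)"
  using Dag_adjoint[OF S_props(2) S_props(2) plus_id_hom] assms plus_id_Dag
  by (simp add: orthoset_adjoint_def)

text \<open>\<open>F\<close> is \<open>h\<close> in coordinates; such an \<open>F\<close> is determined up to \<^const>\<open>par\<close>.\<close>

definition represents :: "'a orthostruct \<Rightarrow> 'a orthostruct \<Rightarrow> ('v \<Rightarrow> 'v) \<Rightarrow> ('a \<Rightarrow> 'a) \<Rightarrow> bool" where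
  "represents X Y F h \<longleftrightarrow> (\<forall>v x. corr X v x \<longrightarrow> corr Y (F v) (h x))"

lemma ex_represents:
  assumes XY: "X \<in> Obj C" "Y \<in> Obj C" "h \<in> Hom C (S X) (S Y)"
  shows "\<exists>G. represents X Y G h"
proof -
  note SX = S_props[OF XY(1)] and SY = S_props[OF XY(2)]
  have "\<exists>v'. \<exists>x. corr X v x \<and> corr Y v' (h x)" if "v \<in> hcarrier (Hbar X)" for v
    using ex_corr_right[OF XY(1) that] ex_corr_left[OF XY(2)] hom_closed[OF SX(2) SY(2) XY(3)] corrD
    by blast
  then obtain G where G: "\<exists>x. corr X v x \<and> corr Y (G v) (h x)" if "v \<in> hcarrier (Hbar X)" for v
    by metis
  have "corr Y (G v) (h x)" if v: "corr X v x" for v x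
  proof -
    obtain y where y: "corr X v y" "corr Y (G v) (h y)"
      using G corrD(1)[OF v] by blast
    then have "par (S X) y x"
      using corr_par_right[OF XY(1)] v corrD(2) by blast
    then have "par (S Y) (h y) (h x)"
      using hom_preserves_par[OF SX(2) SY(2) XY(3)] v y(1) corrD(2) by blast
    then show ?thesis
      using corr_par_right[OF XY(2) y(2)] hom_closed[OF SX(2) SY(2) XY(3)] v corrD(2) by blast
  qed
  then show ?thesis
    unfolding represents_def by blast
qed

lemma represents_par:
  assumes X: "X \<in> Obj C" and Y: "Y \<in> Obj C" and F: "represents X Y F h"
  shows "represents X Y G h \<longleftrightarrow> (\<forall>v\<in>hcarrier (Hbar X). G v \<in> hcarrier (Hbar Y) \<and>
      par (orthoset_of (Hbar Y)) (F v) (G v))"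
proof
  assume G: "represents X Y G h"
  show "\<forall>v\<in>hcarrier (Hbar X). G v \<in> hcarrier (Hbar Y) \<and> par (orthoset_of (Hbar Y)) (F v) (G v)"
  proof
    fix v assume "v \<in> hcarrier (Hbar X)"
    then obtain x where "corr X v x"
      using ex_corr_right X by blast
    with F G have "corr Y (F v) (h x)" "corr Y (G v) (h x)"
      by (auto simp: represents_def)
    then show "G v \<in> hcarrier (Hbar Y) \<and> par (orthoset_of (Hbar Y)) (F v) (G v)"
      using corr_par_left corrD(1) by blast
  qed
next
  assume *: "\<forall>v\<in>hcarrier (Hbar X). G v \<in> hcarrier (Hbar Y) \<and> par (orthoset_of (Hbar Y)) (F v) (G v)"
  show "represents X Y G h"
    unfolding represents_def
  proof (intro allI impI)
    fix v x assume v: "corr X v x"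
    then have "corr Y (F v) (h x)"
      using F by (simp add: represents_def)
    then show "corr Y (G v) (h x)"
      using * corr_par_left corrD(1)[OF v] by blast
  qed
qed

lemma represents_closed:
  assumes "X \<in> Obj C" "represents X Y F h" "v \<in> hcarrier (Hbar X)"
  shows "F v \<in> hcarrier (Hbar Y)"
  using ex_corr_right[OF assms(1,3)] assms(2) corrD(1) unfolding represents_def by blast

lemma represents_adjoint:
  assumes XY: "X \<in> Obj C" "Y \<in> Obj C" and f: "f \<in> Hom C X Y"
    and F: "represents X Y F (plus_id X Y f)" and F': "represents Y X F' (plus_id Y X (Dag C X Y f))"
    and v: "v \<in> hcarrier (Hbar X)" "w \<in> hcarrier (Hbar Y)"
  shows "form (Hbar Y) (F v) w = 0 \<longleftrightarrow> form (Hbar X) v (F' w) = 0"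
proof -
  obtain x y where xy: "corr X v x" "corr Y w y"
    using ex_corr_right XY v by blast
  then have "corr Y (F v) (plus_id X Y f x)" "corr X (F' w) (plus_id Y X (Dag C X Y f) y)"
    using F F' by (auto simp: represents_def)
  then show ?thesis
    using corr_perp[OF XY(2) _ xy(2)] corr_perp[OF XY(1) xy(1)]
      plus_id_adjoint[OF XY f corrD(2)[OF xy(1)] corrD(2)[OF xy(2)]] by simp
qed

text \<open>\<open>f \<oplus> id\<close> carries the copy of \<open>Z\<close> in \<open>X \<oplus> Z\<close> to that in \<open>Y \<oplus> Z\<close>, and both have the same
  coordinates, given by \<open>r\<close>.\<close>

lemma represents_fixes:
  assumes XY: "X \<in> Obj C" "Y \<in> Obj C" and f: "f \<in> Hom C X Y"
    and F: "represents X Y F (plus_id X Y f)" and w: "w \<in> hcarrier HZ"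
  shows "par (orthoset_of (Hbar Y)) (F w) w"
proof -
  obtain z where z: "z \<in> ocarrier Z" "r (par_class Z z) = par_class (orthoset_of HZ) w"
    using ex_r_preimage[OF w] by blast
  have "corr Y (F w) (iZ Y z)"
    using F corr_iZ[OF XY(1) z(1) w z(2)] plus_id_iZ[OF XY f z(1)] by (metis represents_def)
  moreover have "corr Y w (iZ Y z)"
    using corr_iZ[OF XY(2) z(1) w z(2)] .
  ultimately show ?thesis
    using corr_par_left corrD(1) by blast
qed

abbreviation L where "L \<equiv> L_obj HZ Hbar"

text \<open>The property that defines \<open>L f\<close>, expressed in coordinates; see \<open>linearises_iff\<close> below.\<close>

definition linearises :: "'a orthostruct \<Rightarrow> 'a orthostruct \<Rightarrow> ('a \<Rightarrow> 'a) \<Rightarrow> ('v \<Rightarrow> 'v) \<Rightarrow> bool" where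
  "linearises X Y f \<phi> \<longleftrightarrow> linear_map (L X) (L Y) \<phi> \<and>
     represents X Y (oplus_id HZ (Hbar X) (Hbar Y) \<phi>) (plus_id X Y f)"

text \<open>As \<open>f \<oplus> id\<close> and its dagger \<open>f\<^sup>* \<oplus> id\<close> are adjoint and both fix the copy of \<open>Z\<close>, maps that
  represent them form an adjoint pair to which the linearisation applies.\<close>

lemma ex_linearises:
  assumes XY: "X \<in> Obj C" "Y \<in> Obj C" and f: "f \<in> Hom C X Y"
  shows "\<exists>\<phi>. linearises X Y f \<phi>"
proof -
  have f': "Dag C X Y f \<in> Hom C Y X"
    using XY f by (rule Dag_hom)
  obtain G where G: "represents X Y G (plus_id X Y f)"
    using ex_represents[OF XY plus_id_hom[OF XY f]] by blast
  obtain G' where G': "represents Y X G' (plus_id Y X (Dag C X Y f))"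
    using ex_represents[OF XY(2,1) plus_id_hom[OF XY(2,1) f']] by blast
  interpret extension_pair star HZ "Hbar X" "Hbar Y"
    using pair[OF XY] .
  interpret fixing_adjoint_pair star HZ "Hbar X" "Hbar Y" G G' "d\<^sub>1" "d\<^sub>2"
    using represents_closed[OF XY(1) G] represents_closed[OF XY(2) G']
      represents_adjoint[OF XY f G G'] represents_fixes[OF XY f G]
      represents_fixes[OF XY(2,1) f' G'] d
    by unfold_locales auto
  have "represents X Y (oplus_id HZ (Hbar X) (Hbar Y) linearisation) (plus_id X Y f)"
    using represents_par[OF XY G] par_sym[OF linearisation_par]
      oplus_id_closed[OF linear_map_linearisation] by blast
  then show ?thesis
    using linear_map_linearisation unfolding linearises_def L_obj_def by blast
qed

lemma linearises_unique:
  assumes XY: "X \<in> Obj C" "Y \<in> Obj C" and \<phi>: "linearises X Y f \<phi>" "linearises X Y f \<phi>'"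
  shows "\<phi> = \<phi>'"
proof -
  interpret extension_pair star HZ "Hbar X" "Hbar Y"
    using pair[OF XY] .
  show ?thesis
    using \<phi> represents_par[OF XY] d unfolding linearises_def L_obj_def
    by (intro linear_map_eqI[of \<phi> \<phi>' "d\<^sub>1"]) blast+
qed

abbreviation L_map where "L_map \<equiv> L_mor C Z S iX iZ HZ Hbar rbar"

lemma linearises_iff:
  assumes XY: "X \<in> Obj C" "Y \<in> Obj C" and f: "f \<in> Hom C X Y"
    and \<phi>: "linear_map (L X) (L Y) \<phi>"
  shows "linearises X Y f \<phi> \<longleftrightarrow>
    (\<forall>p\<in>ocarrier (P_orthoset (S X)). rbar Y (P_map (S X) (S Y) (plus_id X Y f) p) =
       P_map (orthoset_of (Hbar X)) (orthoset_of (Hbar Y)) (oplus_id HZ (Hbar X) (Hbar Y) \<phi>) (rbar X p))"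
proof -
  interpret extension_pair star HZ "Hbar X" "Hbar Y"
    using pair[OF XY] .
  note SX = S_props[OF XY(1)] and SY = S_props[OF XY(2)]
  let ?h = "plus_id X Y f" and ?F = "oplus_id HZ (Hbar X) (Hbar Y) \<phi>"
  have \<phi>': "linear_map dom.compl cod.compl \<phi>"
    using \<phi> by (simp add: L_obj_def)
  have P_h: "P_map (S X) (S Y) ?h (par_class (S X) x) = par_class (S Y) (?h x)"
    if "x \<in> ocarrier (S X)" for x
    using that hom_closed[OF SX(2) SY(2) plus_id_hom[OF XY f]]
      hom_preserves_par[OF SX(2) SY(2) plus_id_hom[OF XY f]]
    by (intro P_map_par_class) auto
  have P_F: "P_map (orthoset_of (Hbar X)) (orthoset_of (Hbar Y)) ?F (par_class (orthoset_of (Hbar X)) v) =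
      par_class (orthoset_of (Hbar Y)) (?F v)" if "v \<in> hcarrier (Hbar X)" for v
    using that oplus_id_closed[OF \<phi>'] oplus_id_par[OF \<phi>'] by (intro P_map_par_class) auto
  have "corr Y (?F v) (?h x) \<longleftrightarrow> rbar Y (P_map (S X) (S Y) ?h (par_class (S X) x)) =
      P_map (orthoset_of (Hbar X)) (orthoset_of (Hbar Y)) ?F (rbar X (par_class (S X) x))"
    if "corr X v x" for v x
    using that P_h P_F oplus_id_closed[OF \<phi>'] hom_closed[OF SX(2) SY(2) plus_id_hom[OF XY f]]
    by (simp add: corr_def)
  then show ?thesis
    using \<phi> ex_corr_left[OF XY(1)] corrD(2) unfolding linearises_def represents_def P_carrier
    by blast
qed

lemma L_map_eqI:
  assumes XY: "X \<in> Obj C" "Y \<in> Obj C" and f: "f \<in> Hom C X Y" and \<phi>: "linearises X Y f \<phi>"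
  shows "L_map X Y f = \<phi>"
proof -
  have "L_map X Y f = (THE \<phi>. linearises X Y f \<phi>)"
    unfolding L_mor_def using linearises_iff[OF XY f]
    by (intro arg_cong[of _ _ The] ext) (auto simp: plus_id_def linearises_def)
  also have "\<dots> = \<phi>"
    using \<phi> linearises_unique[OF XY _ \<phi>] by (rule the_equality)
  finally show ?thesis .
qed

lemma linearises_L_map:
  assumes "X \<in> Obj C" "Y \<in> Obj C" "f \<in> Hom C X Y"
  shows "linearises X Y f (L_map X Y f)"
  using ex_linearises[OF assms] L_map_eqI[OF assms] by auto

lemma L_obj_hermitian: "X \<in> Obj C \<Longrightarrow> hermitian_space star (L X)"
  using hermitian_extension.hermitian_compl[OF extension] by (simp add: L_obj_def)

text \<open>\<open>L f \<oplus> id\<close> and \<open>L f\<^sup>* \<oplus> id\<close> are adjoint as maps of orthosets, because they represent adjoint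
  maps, and this yields adjointness of \<open>L f\<close> and \<open>L f\<^sup>*\<close> with respect to the forms.\<close>

lemma linear_adjoint_L_map:
  assumes XY: "X \<in> Obj C" "Y \<in> Obj C" and f: "f \<in> Hom C X Y"
  shows "linear_adjoint (L X) (L Y) (L_map X Y f) (L_map Y X (Dag C X Y f))"
proof -
  interpret extension_pair star HZ "Hbar X" "Hbar Y"
    using pair[OF XY] .
  have f': "Dag C X Y f \<in> Hom C Y X"
    using XY f by (rule Dag_hom)
  have lin: "linearises X Y f (L_map X Y f)" "linearises Y X (Dag C X Y f) (L_map Y X (Dag C X Y f))"
    using linearises_L_map XY f f' by auto
  then show ?thesis
    using represents_adjoint[OF XY f] d unfolding linearises_def L_obj_def
    by (intro linear_adjointI[of _ _ "d\<^sub>1"]) blast+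
qed

lemma linearises_Idn:
  assumes X: "X \<in> Obj C"
  shows "linearises X X (Idn C X) (\<lambda>u\<in>hcarrier (L X). u)"
proof -
  interpret extension_pair star HZ "Hbar X" "Hbar X"
    using pair[OF X X] .
  have "oplus_id HZ (Hbar X) (Hbar X) (\<lambda>u\<in>hcarrier (L X). u) v = v" if v: "v \<in> hcarrier (Hbar X)" for v
  proof -
    obtain u w where "u \<in> hcarrier dom.compl" "w \<in> hcarrier HZ" "v = vadd (Hbar X) u w"
      using dom.split_vector v .
    then show ?thesis
      by (simp add: oplus_id_vadd L_obj_def)
  qed
  moreover have "plus_id X X (Idn C X) x = x" if "x \<in> ocarrier (S X)" for x
    using that Idn_map[OF S_props(2)[OF X]] by (simp add: plus_id_Idn[OF X])
  ultimately show ?thesis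
    using linear_map_id[OF L_obj_hermitian[OF X]] corrD
    unfolding linearises_def represents_def by simp
qed

text \<open>\<open>(\<psi> \<circ> \<phi>) \<oplus> id = (\<psi> \<oplus> id) \<circ> (\<phi> \<oplus> id)\<close> represents \<open>(g \<oplus> id) \<circ> (f \<oplus> id) = (g \<circ> f) \<oplus> id\<close>.\<close>

lemma linearises_Comp:
  assumes obj: "X \<in> Obj C" "Y \<in> Obj C" "W \<in> Obj C" and hom: "f \<in> Hom C X Y" "g \<in> Hom C Y W"
    and \<phi>: "linearises X Y f \<phi>" and \<psi>: "linearises Y W g \<psi>"
  shows "linearises X W (Comp C X Y W g f) (compose (hcarrier (L X)) \<psi> \<phi>)"
proof -
  interpret XY: extension_pair star HZ "Hbar X" "Hbar Y"
    using pair[OF obj(1,2)] .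
  interpret YW: extension_pair star HZ "Hbar Y" "Hbar W"
    using pair[OF obj(2,3)] .
  interpret XW: extension_pair star HZ "Hbar X" "Hbar W"
    using pair[OF obj(1,3)] .
  have lin: "linear_map (L X) (L Y) \<phi>" "linear_map (L Y) (L W) \<psi>"
    using \<phi> \<psi> by (simp_all add: linearises_def)
  have "oplus_id HZ (Hbar X) (Hbar W) (compose (hcarrier (L X)) \<psi> \<phi>) v =
      oplus_id HZ (Hbar Y) (Hbar W) \<psi> (oplus_id HZ (Hbar X) (Hbar Y) \<phi> v)"
    if v: "v \<in> hcarrier (Hbar X)" for v
  proof -
    obtain u w where uw: "u \<in> hcarrier XY.dom.compl" "w \<in> hcarrier HZ" "v = vadd (Hbar X) u w"
      using XY.dom.split_vector v .
    moreover have "\<phi> u \<in> hcarrier XY.cod.compl"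
      using linear_map_closed[OF lin(1)] uw(1) by (simp add: L_obj_def)
    ultimately show ?thesis
      by (simp add: XY.oplus_id_vadd YW.oplus_id_vadd XW.oplus_id_vadd L_obj_def compose_eq)
  qed
  moreover have "plus_id X W (Comp C X Y W g f) x = plus_id Y W g (plus_id X Y f x)"
    if "x \<in> ocarrier (S X)" for x
    using that Comp_map[OF S_props(2) S_props(2) S_props(2) plus_id_hom plus_id_hom] obj hom
    by (simp add: plus_id_Comp compose_eq)
  ultimately show ?thesis
    using \<phi> \<psi> linear_map_compose[OF L_obj_hermitian[OF obj(1)] lin] corrD
    unfolding linearises_def represents_def by simp
qed

lemma L_obj_OMS:
  assumes "X \<in> Obj C"
  shows "L X \<in> Obj (OMS star)"
proof -
  interpret hermitian_extension star HZ "Hbar X"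
    using extension[OF assms] .
  have "orthoclosed (orthoset_of (Hbar X)) (orthocomp (orthoset_of (Hbar X)) (hcarrier HZ))"
    by (intro orthoclosed_orthocomp) auto
  then show ?thesis
    using uniform_orthomodular_space_subspace[OF Hbar[OF assms]]
    by (simp add: OMS_simps L_obj_def hspace_complement_def)
qed

lemma dagger_functor_L: "dagger_functor C (OMS star) L L_map"
proof (intro dagger_functor.intro dagger_category_axioms OMS_dagger_category dagger_functor_axioms.intro)
  show "L A \<in> Obj (OMS star)" if "A \<in> Obj C" for A
    using L_obj_OMS that .
  show "L_map A A (Idn C A) = Idn (OMS star) (L A)" if "A \<in> Obj C" for A
    using that L_map_eqI[OF that that Idn_hom linearises_Idn] by (simp add: OMS_simps)
  fix A B f assume AB: "A \<in> Obj C" "B \<in> Obj C" and f: "f \<in> Hom C A B"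
  note adj = linear_adjoint_L_map[OF AB f] and lin = linearises_L_map[OF AB f]
  show "L_map A B f \<in> Hom (OMS star) (L A) (L B)"
    using adj lin by (auto simp: OMS_simps linearises_def)
  show "L_map B A (Dag C A B f) = Dag (OMS star) (L A) (L B) (L_map A B f)"
    using Dag_OMS[OF L_obj_hermitian[OF AB(1)] adj] by simp
  fix E g assume E: "E \<in> Obj C" and g: "g \<in> Hom C B E"
  show "L_map A E (Comp C A B E g f) = Comp (OMS star) (L A) (L B) (L E) (L_map B E g) (L_map A B f)"
    using L_map_eqI[OF AB(1) E Comp_hom[OF AB E f g]
      linearises_Comp[OF AB E f g lin linearises_L_map[OF AB(2) E g]]]
    by (simp add: OMS_simps)
qed

end

lemma has_dimension_orthogonal_pair:
  assumes "has_dimension H n" "n \<ge> 2"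
  obtains u v where "u \<in> hcarrier H" "v \<in> hcarrier H" "u \<noteq> vzero H" "v \<noteq> vzero H" "form H u v = 0"
proof -
  obtain D where D: "orthogonal_set (orthoset_of H) D" "card D = n"
    using assms(1) by (auto simp: has_dimension_def)
  then have "finite D" "\<not> card D \<le> Suc 0"
    using assms(2) by (auto intro: card_ge_0_finite)
  then obtain u v where "u \<in> D" "v \<in> D" "u \<noteq> v"
    by (auto simp: card_le_Suc0_iff_eq)
  with D(1) show ?thesis
    by (intro that[of u v]) (auto simp: orthogonal_set_def proper_def pairwise_def)
qed

theorem proposition8p1:
  fixes C :: "('a orthostruct, 'a \<Rightarrow> 'a) dagcat"
    and star :: "'f::division_ring \<Rightarrow> 'f"
    and Z :: "'a orthostruct"
    and HZ :: "('f, 'v) hspace"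
    and r :: "'a set \<Rightarrow> 'v set"
    and S :: "'a orthostruct \<Rightarrow> 'a orthostruct"
    and iX iZ :: "'a orthostruct \<Rightarrow> 'a \<Rightarrow> 'a"
    and Hbar :: "'a orthostruct \<Rightarrow> ('f, 'v) hspace"
    and rbar :: "'a orthostruct \<Rightarrow> 'a set \<Rightarrow> 'v set"
  assumes C: "orthoset_dagger_category C"
    and nonzero_rank: "\<exists>X\<in>Obj C. rank X \<noteq> 0"
    and H1: "has_dagger_biproducts C"
    and H2: "\<And>X A. X \<in> Obj C \<Longrightarrow> orthoclosed X A \<Longrightarrow>
        sub_orthoset X A \<in> Obj C \<and>
        sub_orthoset X (orthocomp X A) \<in> Obj C \<and>
        (\<lambda>x\<in>A. x) \<in> Hom C (sub_orthoset X A) X \<and>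
        (\<lambda>x\<in>orthocomp X A. x) \<in> Hom C (sub_orthoset X (orthocomp X A)) X \<and>
        dagger_biproduct C (sub_orthoset X A) (sub_orthoset X (orthocomp X A)) X
          (\<lambda>x\<in>A. x) (\<lambda>x\<in>orthocomp X A. x)"
    and H3a: "\<And>X. X \<in> Obj C \<Longrightarrow> unital X \<Longrightarrow> dagger_simple C X"
    and H3b: "\<And>X Y. X \<in> Obj C \<Longrightarrow> Y \<in> Obj C \<Longrightarrow> unital X \<Longrightarrow> unital Y \<Longrightarrow>
        \<exists>f. dagger_iso C X Y f"
    and Z: "Z \<in> Obj C" "rank Z = 3"
    and HZ: "uniform_orthomodular_space star HZ" "has_dimension HZ 3"
    and r: "orthoisomorphism (P_orthoset Z) (P_orthoset (orthoset_of HZ)) r"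
    and S: "\<And>X. X \<in> Obj C \<Longrightarrow> dagger_biproduct C X Z (S X) (iX X) (iZ X)"
    and Hbar: "\<And>X. X \<in> Obj C \<Longrightarrow> uniform_orthomodular_space star (Hbar X)"
    and Hbar_sub: "\<And>X. X \<in> Obj C \<Longrightarrow> is_subspace_of HZ (Hbar X)"
    and rbar: "\<And>X. X \<in> Obj C \<Longrightarrow>
        orthoisomorphism (P_orthoset (S X)) (P_orthoset (orthoset_of (Hbar X))) (rbar X)"
    and rbar_r: "\<And>X p. X \<in> Obj C \<Longrightarrow> p \<in> ocarrier (P_orthoset Z) \<Longrightarrow>
        rbar X (P_map Z (S X) (iZ X) p)
        = P_map (orthoset_of HZ) (orthoset_of (Hbar X)) (\<lambda>w\<in>hcarrier HZ. w) (r p)"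
  shows "dagger_functor C (OMS star) (L_obj HZ Hbar) (L_mor C Z S iX iZ HZ Hbar rbar)"
proof -
  obtain N where N: "zero_object C N"
    using H1 by (auto simp: has_dagger_biproducts_def)
  obtain d\<^sub>1 d\<^sub>2 where d: "d\<^sub>1 \<in> hcarrier HZ" "d\<^sub>2 \<in> hcarrier HZ" "d\<^sub>1 \<noteq> vzero HZ" "d\<^sub>2 \<noteq> vzero HZ"
      "form HZ d\<^sub>1 d\<^sub>2 = 0"
    using has_dimension_orthogonal_pair[OF HZ(2)] by auto
  have "coordinatisation C star N Z HZ r S iX iZ Hbar rbar d\<^sub>1 d\<^sub>2"
    using N Z(1) HZ(1) d r S Hbar Hbar_sub rbar rbar_r
    by (intro coordinatisation.intro C coordinatisation_axioms.intro)
  then show ?thesis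
    by (rule coordinatisation.dagger_functor_L)
qed

end
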